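(* Let $\gamma:J\to\mathcal S$ be a transversal curve and let $t_0\in J$. The following are equivalent: (1) $\gamma(t_0)$ is a CR inflection point; (2) $d\mathcal C_\gamma|_{t_0}=0$, where $\mathcal C_\gamma:J\to\Omega_+$ is the osculating curve of $\gamma$; (3) the order of contact of $\gamma$ with its osculating chain $\mathcal C_\gamma|_{t_0}$ at the contact point $\gamma(t_0)$ is strictly bigger than $1$.
   Context: $\mathbb C^{2,1}$ is $\mathbb C^3$ with the Hermitian form $\langle \mathbf z,\mathbf w\rangle={}^t\overline{\mathbf z}\,\mathbf h\,\mathbf w$, $\mathbf h=\begin{pmatrix}0&0&i\\0&1&0\\-i&0&0\end{pmatrix}$, of signature $(2,1)$; a nonzero vector is spacelike, timelike or lightlike if $\langle\mathbf z,\mathbf z\rangle$ is positive, negative or zero. $\mathcal N$ is the set of lightlike vectors and $\mathcal S=\{[\mathbf z]\in\mathbb{CP}^2:\langle\mathbf z,\mathbf z\rangle=0\}$ (a model of the standard CR 3-sphere), with contact form $\zeta$ equal to the restriction to $T\mathcal S$ of $-i\langle\mathbf z,d\mathbf z\rangle/({}^t\overline{\mathbf z}\mathbf z)$. Let $J\subseteq\mathbb R$ be an interval. A lift of a smooth curve $\gamma:J\to\mathcal S$ is a smooth map $\Gamma:J\to\mathcal N$ with $\gamma(t)=[\Gamma(t)]$. The curve $\gamma$ is transversal if $\zeta(\gamma'(t))\ne0$ for all $t$; transversal curves are always assumed positively parametrized, $\zeta(\gamma')>0$, i.e. $-i\langle\Gamma,\Gamma'\rangle>0$. For a spacelike vector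 $\mathbf S$, the chain $\mathcal C_{[\mathbf S]}$ is $\{[\mathbf z]\in\mathcal S:\langle\mathbf S,\mathbf z\rangle=0\}$; the set of all chains is identified, via $\mathcal C_{[\mathbf S]}\leftrightarrow[\mathbf S]$, with the open set $\Omega_+\subset\mathbb{CP}^2$ of spacelike lines. If $\gamma$ is transversal with lift $\Gamma$, the complex plane spanned by $\Gamma(t),\Gamma'(t)$ has signature $(1,1)$ and the set of null lines contained in it is a chain, independent of the lift, called the osculating chain $\mathcal C_\gamma|_t$ of $\gamma$ at $\gamma(t)$; the map $\mathcal C_\gamma:J\to\Omega_+$, $t\mapsto\mathcal C_\gamma|_t$, is smooth and is called the osculating curve. The point $\gamma(t_0)$ is a CR inflection point if $\det(\Gamma,\Gamma',\Gamma'')|_{t_0}=0$ for one (equivalently every) lift $\Gamma$. The order of contact of $\gamma$ with the osculating chain at $\gamma(t_0)$ is strictly bigger than $1$ if there is a regular parametrization $\beta$ of the chain, defined near $t_0$, with $\beta(t_0)=\gamma(t_0)$, such that $\gamma$ and $\beta$ have the same 2-jet at $t_0$. *)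

theory Defs
  imports "HOL-Analysis.Analysis"
begin

section \<open>Smooth maps on an interval\<close>

text \<open>
  Derivatives are taken within the domain, hence are one-sided at an end point that belongs
  to it. The domains used below are nondegenerate intervals, where such derivatives are unique.
\<close>

definition D :: "real set \<Rightarrow> (real \<Rightarrow> 'a::real_normed_vector) \<Rightarrow> real \<Rightarrow> 'a" where
  "D J f = (\<lambda>t. vector_derivative f (at t within J))"

definition smooth_map :: "real set \<Rightarrow> (real \<Rightarrow> 'a::real_normed_vector) \<Rightarrow> bool" where
  "smooth_map J f \<longleftrightarrow> (\<forall>n. \<forall>t\<in>J. (D J ^^ n) f differentiable (at t within J))"


section \<open>The Hermitian space and the complex projective plane\<close>

definition hmat :: "complex^3^3" where
  "hmat = vector [vector [0, 0, \<i>], vector [0, 1, 0], vector [- \<i>, 0, 0]]"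

definition herm :: "complex^3 \<Rightarrow> complex^3 \<Rightarrow> complex" where
  "herm z w = (\<Sum>j\<in>UNIV. cnj (z $ j) * (hmat *v w) $ j)"

text \<open>\<open>herm z z\<close> is real, so only its real part is compared with zero.\<close>

definition spacelike :: "complex^3 \<Rightarrow> bool" where
  "spacelike z \<longleftrightarrow> z \<noteq> 0 \<and> Re (herm z z) > 0"

definition lightlike :: "complex^3 \<Rightarrow> bool" where
  "lightlike z \<longleftrightarrow> z \<noteq> 0 \<and> herm z z = 0"

text \<open>
  Points of \<open>\<complex>P\<^sup>2\<close> are the complex lines through the origin; \<open>vec.span\<close> is the
  complex span, whereas the unqualified \<open>span\<close> would be the real one.
\<close>

definition proj :: "complex^3 \<Rightarrow> (complex^3) set" where
  "proj z = vec.span {z}"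

definition CP2 :: "(complex^3) set set" where
  "CP2 = {proj z |z. z \<noteq> 0}"

definition CRsphere :: "(complex^3) set set" where
  "CRsphere = {proj z |z. lightlike z}"

definition Omega_plus :: "(complex^3) set set" where
  "Omega_plus = {proj S |S. spacelike S}"

text \<open>
  The standard affine charts: \<open>chart k\<close> sends \<open>[z]\<close> with \<open>z\<^sub>k \<noteq> 0\<close> to \<open>(z\<^sub>j / z\<^sub>k)\<^sub>j\<close>. The
  redundant \<open>k\<close>-th coordinate, constantly 1, is kept, so that a chart is at the same time
  a local section of the projection \<open>z \<mapsto> [z]\<close>.
\<close>

definition chart_dom :: "3 \<Rightarrow> (complex^3) set set" where
  "chart_dom k = {L \<in> CP2. \<exists>z\<in>L. z $ k \<noteq> 0}"

definition chart :: "3 \<Rightarrow> (complex^3) set \<Rightarrow> complex^3" where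
  "chart k L = (THE w. w \<in> L \<and> w $ k = 1)"

lemma proj_in_chart_dom:
  assumes "z $ k \<noteq> 0"
  shows "proj z \<in> chart_dom k"
proof -
  have "z \<noteq> 0" using assms by auto
  moreover have "z \<in> proj z" by (simp add: proj_def vec.span_base)
  ultimately show ?thesis using assms by (auto simp: chart_dom_def CP2_def)
qed

lemma chart_proj:
  assumes "z $ k \<noteq> 0"
  shows "chart k (proj z) = (\<chi> j. z $ j / z $ k)"
  unfolding chart_def
proof (rule the_equality)
  have "(\<chi> j. z $ j / z $ k) = (1 / z $ k) *s z"
    by (simp add: vec_eq_iff)
  then show "(\<chi> j. z $ j / z $ k) \<in> proj z \<and> (\<chi> j. z $ j / z $ k) $ k = 1"
    using assms by (auto simp: proj_def vec.span_singleton)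
next
  fix w assume "w \<in> proj z \<and> w $ k = 1"
  then have "w \<in> range (\<lambda>c. c *s z)" and one: "w $ k = 1"
    by (simp_all add: proj_def vec.span_singleton)
  then obtain c where c: "w = c *s z" by blast
  with one have "c * z $ k = 1" by simp
  then show "w = (\<chi> j. z $ j / z $ k)"
    using assms c by (simp add: vec_eq_iff field_simps)
qed


section \<open>Curves in the projective plane\<close>

definition smooth_curve :: "real set \<Rightarrow> (real \<Rightarrow> (complex^3) set) \<Rightarrow> bool" where
  "smooth_curve J c \<longleftrightarrow> c ` J \<subseteq> CP2 \<and>
     (\<forall>t\<in>J. \<exists>k. \<exists>e>0. c ` (J \<inter> ball t e) \<subseteq> chart_dom k \<and>
        smooth_map (J \<inter> ball t e) (chart k \<circ> c))"

text \<open>The vanishing of the differential of \<open>c\<close> at \<open>t\<close>.\<close>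

definition zero_differential :: "real set \<Rightarrow> (real \<Rightarrow> (complex^3) set) \<Rightarrow> real \<Rightarrow> bool" where
  "zero_differential J c t \<longleftrightarrow>
     (\<forall>k. c t \<in> chart_dom k \<longrightarrow> ((chart k \<circ> c) has_vector_derivative 0) (at t within J))"

text \<open>The case \<open>i = 0\<close> expresses that the two curves agree at \<open>t\<close>.\<close>

definition same_jet ::
  "nat \<Rightarrow> real set \<Rightarrow> (real \<Rightarrow> (complex^3) set) \<Rightarrow> real set \<Rightarrow> (real \<Rightarrow> (complex^3) set) \<Rightarrow> real \<Rightarrow> bool"
  where
  "same_jet n J c I b t \<longleftrightarrow>
     (\<forall>k. c t \<in> chart_dom k \<longrightarrow>
       (\<forall>i\<le>n. (D J ^^ i) (chart k \<circ> c) t = (D I ^^ i) (chart k \<circ> b) t))"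


section \<open>Transversal curves, chains and CR inflection points\<close>

text \<open>
  The value at \<open>v\<close> of \<open>- i \<langle>z, dz\<rangle> / |z|\<^sup>2\<close>. It is real on vectors \<open>v\<close> tangent to the null cone
  at \<open>z\<close>, since then \<open>Re \<langle>z, v\<rangle> = 0\<close>; being homogeneous, it may be evaluated along any local lift
  of a curve in the sphere, in particular along those given by the charts.
\<close>

definition contact_form :: "complex^3 \<Rightarrow> complex^3 \<Rightarrow> real" where
  "contact_form z v = Re (- \<i> * herm z v / (\<Sum>j\<in>UNIV. cnj (z $ j) * z $ j))"

definition transversal :: "real set \<Rightarrow> (real \<Rightarrow> (complex^3) set) \<Rightarrow> bool" where
  "transversal J \<gamma> \<longleftrightarrow> smooth_curve J \<gamma> \<and> \<gamma> ` J \<subseteq> CRsphere \<and>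
     (\<forall>t\<in>J. \<forall>k. \<gamma> t \<in> chart_dom k \<longrightarrow>
        contact_form (chart k (\<gamma> t)) (D J (chart k \<circ> \<gamma>) t) > 0)"

definition lift_of :: "real set \<Rightarrow> (real \<Rightarrow> (complex^3) set) \<Rightarrow> (real \<Rightarrow> complex^3) \<Rightarrow> bool" where
  "lift_of J \<gamma> \<Gamma> \<longleftrightarrow> smooth_map J \<Gamma> \<and> (\<forall>t\<in>J. lightlike (\<Gamma> t) \<and> \<gamma> t = proj (\<Gamma> t))"

definition chain :: "complex^3 \<Rightarrow> (complex^3) set set" where
  "chain S = {proj z |z. lightlike z \<and> herm S z = 0}"

text \<open>The complex plane spanned by \<open>\<Gamma>(t)\<close> and \<open>\<Gamma>'(t)\<close>, which is the same for all lifts \<open>\<Gamma>\<close>.\<close>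

definition osculating_plane ::
  "real set \<Rightarrow> (real \<Rightarrow> (complex^3) set) \<Rightarrow> real \<Rightarrow> (complex^3) set" where
  "osculating_plane J \<gamma> t =
     (THE W. \<exists>\<Gamma>. lift_of J \<gamma> \<Gamma> \<and> W = vec.span {\<Gamma> t, D J \<Gamma> t})"

definition osculating_chain ::
  "real set \<Rightarrow> (real \<Rightarrow> (complex^3) set) \<Rightarrow> real \<Rightarrow> (complex^3) set set" where
  "osculating_chain J \<gamma> t = {L \<in> CRsphere. L \<subseteq> osculating_plane J \<gamma> t}"

text \<open>The osculating chain as a point of \<open>Omega_plus\<close>, through the identification of
  \<open>chain S\<close> with \<open>[S]\<close>.\<close>

definition osculating_curve ::
  "real set \<Rightarrow> (real \<Rightarrow> (complex^3) set) \<Rightarrow> real \<Rightarrow> (complex^3) set" where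
  "osculating_curve J \<gamma> t =
     (THE P. \<exists>S. spacelike S \<and> P = proj S \<and> chain S = osculating_chain J \<gamma> t)"

definition CR_inflection :: "real set \<Rightarrow> (real \<Rightarrow> (complex^3) set) \<Rightarrow> real \<Rightarrow> bool" where
  "CR_inflection J \<gamma> t \<longleftrightarrow>
     (\<exists>\<Gamma>. lift_of J \<gamma> \<Gamma> \<and>
        det (transpose (vector [\<Gamma> t, D J \<Gamma> t, (D J ^^ 2) \<Gamma> t] :: complex^3^3)) = 0)"

text \<open>
  The parametrization \<open>\<beta>\<close> lives on an open interval around \<open>t\<close>, also when \<open>t\<close> is an
  end point of \<open>J\<close>.
\<close>

definition contact_order_gt_1 ::
  "real set \<Rightarrow> (real \<Rightarrow> (complex^3) set) \<Rightarrow> real \<Rightarrow> bool" where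
  "contact_order_gt_1 J \<gamma> t \<longleftrightarrow>
     (\<exists>I \<beta>. open I \<and> is_interval I \<and> t \<in> I \<and>
        smooth_curve I \<beta> \<and> (\<forall>s\<in>I. \<not> zero_differential I \<beta> s) \<and>
        \<beta> ` I \<subseteq> osculating_chain J \<gamma> t \<and> \<beta> t = \<gamma> t \<and> same_jet 2 J \<gamma> I \<beta> t)"

end

theory Submission
  imports Defs
begin

text \<open>
  For a null lift \<open>\<Gamma>\<close> of the curve, let \<open>P = polar \<Gamma> \<Gamma>'\<close> be the vector with
  \<open>\<langle>P, w\<rangle> = det (\<Gamma>, \<Gamma>', w)\<close>. Transversality makes \<open>P\<close> spacelike and spanning the orthogonal complement
  of the osculating plane, so \<open>[P]\<close> is the osculating curve. Since \<open>P' = polar \<Gamma> \<Gamma>''\<close>, the derivative of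
  \<open>[P]\<close> vanishes exactly when \<open>\<Gamma>''\<close> lies in the osculating plane, that is, at an inflection point.
  A curve in the chain lies in this plane together with its derivatives, so contact of order
  greater than 1 forces an inflection. Conversely, at an inflection point the 2-jet of \<open>\<Gamma>\<close> lies in
  the plane and, \<open>\<Gamma>\<close> being null, is realized by a real quadratic parametrization of the chain.
\<close>

section \<open>Calculus of smooth maps on an interval\<close>

text \<open>Without isolated points, derivatives within the set are unique, so \<open>D\<close> can
  be computed from any known vector derivative. The property passes to intersections with open sets,
  which allows restriction to small pieces of \<open>J\<close>.\<close>

definition dense_in_itself :: "'a::topological_space set \<Rightarrow> bool" where
  "dense_in_itself J \<longleftrightarrow> (\<forall>t\<in>J. t islimpt J)"

lemma at_within_Int_open:
  assumes "open U" "s \<in> U"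
  shows "at s within (J \<inter> U) = at s within J"
  by (rule at_within_nhd[OF assms(2,1)]) auto

lemma dense_in_itself_iff: "dense_in_itself J \<longleftrightarrow> (\<forall>t\<in>J. at t within J \<noteq> bot)"
  unfolding dense_in_itself_def using trivial_limit_within by blast

lemma dense_in_itself_Int_open:
  assumes "dense_in_itself J" "open U"
  shows "dense_in_itself (J \<inter> U)"
  using assms at_within_Int_open[of U _ J] by (simp add: dense_in_itself_iff)

lemma dense_in_itself_open:
  fixes U :: "'a::perfect_space set"
  assumes "open U"
  shows "dense_in_itself U"
  using assms by (simp add: dense_in_itself_iff at_within_open[OF _ assms])

text \<open>A connected set with more than one point has no isolated point; the nonempty interior
  excludes a singleton.\<close>

lemma dense_in_itself_interval:
  fixes J :: "real set"
  assumes "is_interval J" "interior J \<noteq> {}"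
  shows "dense_in_itself J"
proof -
  obtain a where "a \<in> interior J" using assms(2) by blast
  then have "a islimpt J" "a \<in> J"
    using interior_limit_point interior_subset by blast+
  then have "J \<noteq> {x}" for x
    using islimpt_finite[of "{x}" a] by auto
  moreover have "connected J"
    using assms(1) is_interval_connected_1 by blast
  ultimately show ?thesis
    unfolding dense_in_itself_def by (metis connected_imp_perfect)
qed

section \<open>Derivatives within a set and their locality\<close>

lemma D_eqI:
  assumes "dense_in_itself J" "t \<in> J" "(f has_vector_derivative v) (at t within J)"
  shows "D J f t = v"
  using assms unfolding D_def dense_in_itself_iff
  by (blast intro: vector_derivative_within)

lemma has_vector_derivative_D:
  "f differentiable (at t within J) \<Longrightarrow> (f has_vector_derivative D J f t) (at t within J)"
  unfolding D_def by (simp add: vector_derivative_works)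

lemma differentiable_iff_vector:
  "f differentiable (at t within J) \<longleftrightarrow> (\<exists>v. (f has_vector_derivative v) (at t within J))"
  using has_vector_derivative_D differentiableI_vector by blast

text \<open>The filters at \<open>s\<close> within \<open>J \<inter> U\<close> and within
  \<open>J\<close> coincide. One statement thus covers restriction of the domain and, with
  \<open>U = UNIV\<close>, replacement of a function by one that agrees with it on \<open>J\<close>
  only.\<close>

lemma has_vector_derivative_cong_local:
  fixes f g :: "real \<Rightarrow> 'a::real_normed_vector"
  assumes "open U" "s \<in> J \<inter> U" "\<And>x. x \<in> J \<inter> U \<Longrightarrow> f x = g x"
  shows "(f has_vector_derivative v) (at s within (J \<inter> U))
     \<longleftrightarrow> (g has_vector_derivative v) (at s within J)"
proof -
  have "(f has_vector_derivative v) (at s within (J \<inter> U))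
     \<longleftrightarrow> (g has_vector_derivative v) (at s within (J \<inter> U))"
    by (rule has_vector_derivative_cong_ev)
       (use assms in \<open>auto simp: eventually_at_topological\<close>)
  moreover have "at s within (J \<inter> U) = at s within J"
    using assms by (auto intro: at_within_Int_open)
  ultimately show ?thesis by simp
qed

lemma differentiable_cong_local:
  fixes f g :: "real \<Rightarrow> 'a::real_normed_vector"
  assumes "open U" "s \<in> J \<inter> U" "\<And>x. x \<in> J \<inter> U \<Longrightarrow> f x = g x"
  shows "f differentiable (at s within (J \<inter> U)) \<longleftrightarrow> g differentiable (at s within J)"
  unfolding differentiable_iff_vector
  using has_vector_derivative_cong_local[of U s J f g, OF assms] by simp

lemma D_cong_local:
  fixes f g :: "real \<Rightarrow> 'a::real_normed_vector"
  assumes "open U" "s \<in> J \<inter> U" "\<And>x. x \<in> J \<inter> U \<Longrightarrow> f x = g x"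
  shows "D (J \<inter> U) f s = D J g s"
  using has_vector_derivative_cong_local[OF assms]
  unfolding D_def vector_derivative_def by presburger

lemma D_iter_cong_local:
  fixes f g :: "real \<Rightarrow> 'a::real_normed_vector"
  assumes "open U" "\<And>x. x \<in> J \<inter> U \<Longrightarrow> f x = g x" "s \<in> J \<inter> U"
  shows "(D (J \<inter> U) ^^ n) f s = (D J ^^ n) g s"
  using assms(3)
proof (induction n arbitrary: s)
  case (Suc n)
  then show ?case using D_cong_local[OF assms(1) Suc.prems Suc.IH] by simp
qed (use assms in simp)

lemma smooth_map_local:
  assumes "open U" "\<And>x. x \<in> J \<inter> U \<Longrightarrow> f x = g x"
  shows "smooth_map (J \<inter> U) f \<longleftrightarrow>
    (\<forall>n. \<forall>t\<in>J \<inter> U. (D J ^^ n) g differentiable (at t within J))"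
  unfolding smooth_map_def
  using differentiable_cong_local[of U _ J "(D (J \<inter> U) ^^ _) f" "(D J ^^ _) g"]
    D_iter_cong_local[OF assms] assms(1) by simp

lemma smooth_map_cong:
  assumes "\<And>x. x \<in> J \<Longrightarrow> f x = g x"
  shows "smooth_map J f \<longleftrightarrow> smooth_map J g"
  using smooth_map_local[of UNIV J f g] assms by (simp add: smooth_map_def)

lemma smooth_map_Int_open:
  assumes "smooth_map J f" "open U"
  shows "smooth_map (J \<inter> U) f"
  using assms smooth_map_local[of U J f f] by (simp add: smooth_map_def)

lemma smooth_map_locally:
  assumes "\<And>t. t \<in> J \<Longrightarrow> \<exists>e>0. smooth_map (J \<inter> ball t e) f"
  shows "smooth_map J f"
  unfolding smooth_map_def
proof (intro allI ballI)
  fix n t assume t: "t \<in> J"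
  then obtain e where "e > 0" "smooth_map (J \<inter> ball t e) f" using assms by blast
  then show "(D J ^^ n) f differentiable (at t within J)"
    using smooth_map_local[of "ball t e" J f f] t by auto
qed

lemma smooth_map_differentiable:
  "smooth_map J f \<Longrightarrow> t \<in> J \<Longrightarrow> f differentiable (at t within J)"
  unfolding smooth_map_def by (auto dest: spec[of _ 0])

lemma smooth_map_continuous:
  "smooth_map J f \<Longrightarrow> t \<in> J \<Longrightarrow> continuous (at t within J) f"
  by (simp add: differentiable_imp_continuous_within smooth_map_differentiable)

lemma smooth_map_has_derivative:
  "smooth_map J f \<Longrightarrow> t \<in> J \<Longrightarrow> (f has_vector_derivative D J f t) (at t within J)"
  by (simp add: has_vector_derivative_D smooth_map_differentiable)

lemma smooth_map_D: "smooth_map J f \<Longrightarrow> smooth_map J (D J f)"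
  unfolding smooth_map_def using funpow_Suc_right[of _ "D J"] by (metis comp_apply)

section \<open>Stability of smoothness under algebraic operations\<close>

text \<open>Finite order makes induction possible: the derivative of a product or an inverse again
  involves products and inverses, one order lower.\<close>

definition differentiable_upto :: "nat \<Rightarrow> real set \<Rightarrow> (real \<Rightarrow> 'a::real_normed_vector) \<Rightarrow> bool" where
  "differentiable_upto n J f \<longleftrightarrow> (\<forall>m\<le>n. \<forall>t\<in>J. (D J ^^ m) f differentiable (at t within J))"

lemma smooth_map_iff_upto: "smooth_map J f \<longleftrightarrow> (\<forall>n. differentiable_upto n J f)"
  unfolding smooth_map_def differentiable_upto_def by blast

lemma differentiable_upto_0:
  "differentiable_upto 0 J f \<longleftrightarrow> (\<forall>t\<in>J. f differentiable (at t within J))"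
  by (simp add: differentiable_upto_def)

lemma differentiable_upto_Suc:
  "differentiable_upto (Suc n) J f \<longleftrightarrow>
     (\<forall>t\<in>J. f differentiable (at t within J)) \<and> differentiable_upto n J (D J f)"
proof -
  have "(\<forall>m\<le>Suc n. P m) \<longleftrightarrow> P 0 \<and> (\<forall>m\<le>n. P (Suc m))" for P
    by (metis Suc_le_mono le0 not0_implies_Suc)
  then show ?thesis
    unfolding differentiable_upto_def by (simp add: funpow_Suc_right del: funpow.simps(2))
qed

lemma differentiable_upto_Suc_imp:
  "differentiable_upto (Suc n) J f \<Longrightarrow> differentiable_upto n J f"
  by (simp add: differentiable_upto_def)

text \<open>Differentiation rules identify \<open>D J f\<close> with an explicit expression on
  \<open>J\<close> only; this transfers regularity across such an identification.\<close>

lemma differentiable_upto_cong: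
  assumes "\<And>x. x \<in> J \<Longrightarrow> f x = g x"
  shows "differentiable_upto n J f \<longleftrightarrow> differentiable_upto n J g"
proof -
  have "(D J ^^ m) f differentiable (at t within J)
      \<longleftrightarrow> (D J ^^ m) g differentiable (at t within J)" if "t \<in> J" for m t
    using differentiable_cong_local[of UNIV t J "(D J ^^ m) f" "(D J ^^ m) g"]
      D_iter_cong_local[of UNIV J f g] assms that by simp
  then show ?thesis by (simp add: differentiable_upto_def)
qed

lemma D_linear:
  assumes "bounded_linear h" "dense_in_itself J" "t \<in> J" "f differentiable (at t within J)"
  shows "D J (\<lambda>s. h (f s)) t = h (D J f t)"
  by (rule D_eqI[OF assms(2,3) bounded_linear.has_vector_derivative[OF assms(1)
        has_vector_derivative_D[OF assms(4)]]])

lemma differentiable_upto_linear: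
  assumes "bounded_linear h" "dense_in_itself J"
  shows "differentiable_upto n J f \<Longrightarrow> differentiable_upto n J (\<lambda>s. h (f s))"
proof (induction n arbitrary: f)
  case 0
  then show ?case
    using bounded_linear.has_vector_derivative[OF assms(1)]
    unfolding differentiable_upto_0 differentiable_iff_vector by blast
next
  case (Suc n)
  then have d: "f differentiable (at t within J)" if "t \<in> J" for t
    using that by (auto simp: differentiable_upto_Suc)
  have "differentiable_upto n J (\<lambda>s. h (D J f s))"
    using Suc by (auto simp: differentiable_upto_Suc)
  then have "differentiable_upto n J (D J (\<lambda>s. h (f s)))"
    using differentiable_upto_cong[of J "D J (\<lambda>s. h (f s))" "\<lambda>s. h (D J f s)"]
      D_linear[OF assms _ d] by blast
  moreover have "(\<lambda>s. h (f s)) differentiable (at t within J)" if "t \<in> J" for t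
    using bounded_linear.has_vector_derivative[OF assms(1) has_vector_derivative_D[OF d[OF that]]]
    by (rule differentiableI_vector)
  ultimately show ?case by (simp add: differentiable_upto_Suc)
qed

lemma differentiable_upto_add:
  assumes "dense_in_itself J"
  shows "differentiable_upto n J f \<Longrightarrow> differentiable_upto n J g \<Longrightarrow>
    differentiable_upto n J (\<lambda>s. f s + g s)"
proof (induction n arbitrary: f g)
  case 0
  then show ?case by (simp add: differentiable_upto_0)
next
  case (Suc n)
  then have d: "f differentiable (at t within J)" "g differentiable (at t within J)"
    if "t \<in> J" for t
    using that by (auto simp: differentiable_upto_Suc)
  have "D J (\<lambda>s. f s + g s) t = D J f t + D J g t" if "t \<in> J" for t
    using assms that d by (intro D_eqI has_vector_derivative_add has_vector_derivative_D)
  moreover have "differentiable_upto n J (\<lambda>s. D J f s + D J g s)"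
    using Suc by (auto simp: differentiable_upto_Suc)
  ultimately have "differentiable_upto n J (D J (\<lambda>s. f s + g s))"
    using differentiable_upto_cong[of J "D J (\<lambda>s. f s + g s)" "\<lambda>s. D J f s + D J g s"] by blast
  then show ?case using d by (simp add: differentiable_upto_Suc)
qed

lemma D_bilinear:
  assumes "bounded_bilinear p" "dense_in_itself J" "t \<in> J"
    "f differentiable (at t within J)" "g differentiable (at t within J)"
  shows "D J (\<lambda>s. p (f s) (g s)) t = p (f t) (D J g t) + p (D J f t) (g t)"
  by (rule D_eqI[OF assms(2,3) bounded_bilinear.has_vector_derivative[OF assms(1)
        has_vector_derivative_D[OF assms(4)] has_vector_derivative_D[OF assms(5)]]])

text \<open>By the Leibniz rule the derivative is a sum of two bilinear terms in factors of order
  \<open>n\<close>, so the induction runs over all pairs \<open>f\<close>, \<open>g\<close>. The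
  instances of interest are scalar multiplication, \<open>herm\<close> and \<open>polar\<close>,
  each real bilinear.\<close>

lemma differentiable_upto_bilinear:
  assumes "bounded_bilinear p" "dense_in_itself J"
  shows "differentiable_upto n J f \<Longrightarrow> differentiable_upto n J g \<Longrightarrow>
    differentiable_upto n J (\<lambda>s. p (f s) (g s))"
proof (induction n arbitrary: f g)
  case 0
  then show ?case
    using bounded_bilinear.has_vector_derivative[OF assms(1)]
    unfolding differentiable_upto_0 differentiable_iff_vector by blast
next
  case (Suc n)
  then have d: "f differentiable (at t within J)" "g differentiable (at t within J)"
    if "t \<in> J" for t
    using that by (auto simp: differentiable_upto_Suc)
  have "differentiable_upto n J (D J f)" "differentiable_upto n J (D J g)"
    using Suc.prems by (simp_all add: differentiable_upto_Suc)
  then have "differentiable_upto n J (\<lambda>s. p (f s) (D J g s) + p (D J f s) (g s))"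
    by (intro differentiable_upto_add assms Suc.IH) (rule Suc.prems[THEN differentiable_upto_Suc_imp] | assumption)+
  then have "differentiable_upto n J (D J (\<lambda>s. p (f s) (g s)))"
    using differentiable_upto_cong[of J "D J (\<lambda>s. p (f s) (g s))"
        "\<lambda>s. p (f s) (D J g s) + p (D J f s) (g s)"] D_bilinear[OF assms _ d] by blast
  moreover have "(\<lambda>s. p (f s) (g s)) differentiable (at t within J)" if "t \<in> J" for t
    using bounded_bilinear.has_vector_derivative[OF assms(1)] d[OF that]
    unfolding differentiable_iff_vector by blast
  ultimately show ?case by (simp add: differentiable_upto_Suc)
qed

lemma has_vector_derivative_inverse:
  fixes f :: "real \<Rightarrow> 'a::real_normed_field"
  assumes "(f has_vector_derivative v) (at t within J)" "f t \<noteq> 0"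
  shows "((\<lambda>s. inverse (f s)) has_vector_derivative - (inverse (f t) * v * inverse (f t)))
    (at t within J)"
  using Deriv.has_derivative_inverse[of f t, OF assms(2) assms(1)[unfolded has_vector_derivative_def]]
  by (simp add: has_vector_derivative_def)

text \<open>The derivative of \<open>1/f\<close> is a product of \<open>f'\<close> with two copies
  of \<open>1/f\<close>, to which the induction hypothesis applies.\<close>

lemma differentiable_upto_inverse:
  fixes f :: "real \<Rightarrow> 'a::real_normed_field"
  assumes "dense_in_itself J" "\<And>t. t \<in> J \<Longrightarrow> f t \<noteq> 0"
  shows "differentiable_upto n J f \<Longrightarrow> differentiable_upto n J (\<lambda>s. inverse (f s))"
proof (induction n)
  case 0
  then show ?case
    using has_vector_derivative_inverse assms(2)
    unfolding differentiable_upto_0 differentiable_iff_vector by blast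
next
  case (Suc n)
  then have d: "f differentiable (at t within J)" if "t \<in> J" for t
    using that by (auto simp: differentiable_upto_Suc)
  note der = has_vector_derivative_inverse[OF has_vector_derivative_D[OF d] assms(2)]
  have inv: "differentiable_upto n J (\<lambda>s. inverse (f s))"
    using Suc differentiable_upto_Suc_imp by blast
  have "differentiable_upto n J (\<lambda>s. - (inverse (f s) * D J f s * inverse (f s)))"
    by (intro differentiable_upto_linear[OF bounded_linear_minus[OF bounded_linear_ident]]
          differentiable_upto_bilinear[OF bounded_bilinear_mult] inv assms(1))
       (rule conjunct2[OF Suc.prems[unfolded differentiable_upto_Suc]])
  then have "differentiable_upto n J (D J (\<lambda>s. inverse (f s)))"
    using differentiable_upto_cong[of J "D J (\<lambda>s. inverse (f s))"
        "\<lambda>s. - (inverse (f s) * D J f s * inverse (f s))"] D_eqI[OF assms(1) _ der] by blast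
  moreover have "(\<lambda>s. inverse (f s)) differentiable (at t within J)" if "t \<in> J" for t
    using der[OF that that] by (rule differentiableI_vector)
  ultimately show ?case by (simp add: differentiable_upto_Suc)
qed

lemma smooth_map_const:
  assumes "dense_in_itself J"
  shows "smooth_map J (\<lambda>s. c)"
proof -
  have "differentiable_upto n J (\<lambda>s. c)" for n
  proof (induction n arbitrary: c)
    case (Suc n)
    have "D J (\<lambda>s. c) t = 0" if "t \<in> J" for t
      using assms that by (intro D_eqI has_vector_derivative_const)
    then show ?case
      using Suc differentiable_upto_cong[of J "D J (\<lambda>s. c)" "\<lambda>s. 0"]
      by (simp add: differentiable_upto_Suc)
  qed (simp add: differentiable_upto_0)
  then show ?thesis by (simp add: smooth_map_iff_upto)
qed

lemma smooth_map_primitive: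
  assumes "dense_in_itself J" "smooth_map J g"
    and "\<And>t. t \<in> J \<Longrightarrow> (f has_vector_derivative g t) (at t within J)"
  shows "smooth_map J f"
proof -
  have "D J f t = g t" if "t \<in> J" for t
    using assms that by (intro D_eqI)
  then have "differentiable_upto (Suc n) J f" for n
    using assms differentiable_upto_cong[of J "D J f" g]
    by (auto simp: differentiable_upto_Suc smooth_map_iff_upto intro: differentiableI_vector)
  then show ?thesis
    using differentiable_upto_Suc_imp by (auto simp: smooth_map_iff_upto)
qed

lemma smooth_map_linear:
  "bounded_linear h \<Longrightarrow> dense_in_itself J \<Longrightarrow> smooth_map J f \<Longrightarrow> smooth_map J (\<lambda>s. h (f s))"
  by (simp add: smooth_map_iff_upto differentiable_upto_linear)

lemma smooth_map_bilinear:
  "bounded_bilinear p \<Longrightarrow> dense_in_itself J \<Longrightarrow> smooth_map J f \<Longrightarrow> smooth_map J g \<Longrightarrow>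
    smooth_map J (\<lambda>s. p (f s) (g s))"
  by (simp add: smooth_map_iff_upto differentiable_upto_bilinear)

lemma smooth_map_inverse:
  fixes f :: "real \<Rightarrow> 'a::real_normed_field"
  shows "dense_in_itself J \<Longrightarrow> (\<And>t. t \<in> J \<Longrightarrow> f t \<noteq> 0) \<Longrightarrow> smooth_map J f \<Longrightarrow>
    smooth_map J (\<lambda>s. inverse (f s))"
  by (simp add: smooth_map_iff_upto differentiable_upto_inverse)

lemma D2_bilinear:
  assumes p: "bounded_bilinear p" and J: "dense_in_itself J" "t \<in> J"
    and f: "smooth_map J f" and g: "smooth_map J g"
  shows "(D J ^^ 2) (\<lambda>s. p (f s) (g s)) t =
    p (f t) ((D J ^^ 2) g t) + 2 *\<^sub>R p (D J f t) (D J g t) + p ((D J ^^ 2) f t) (g t)"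
proof -
  note sm = smooth_map_differentiable
  have "(D J ^^ 2) (\<lambda>s. p (f s) (g s)) t = D J (D J (\<lambda>s. p (f s) (g s))) t"
    by (simp add: numeral_2_eq_2)
  also have "\<dots> = D J (\<lambda>s. p (f s) (D J g s) + p (D J f s) (g s)) t"
    using D_cong_local[of UNIV t J "D J (\<lambda>s. p (f s) (g s))"
        "\<lambda>s. p (f s) (D J g s) + p (D J f s) (g s)"]
      D_bilinear[OF p J(1) _ sm[OF f] sm[OF g]] J(2) by simp
  also have "\<dots> = D J (\<lambda>s. p (f s) (D J g s)) t + D J (\<lambda>s. p (D J f s) (g s)) t"
    by (intro D_eqI has_vector_derivative_add smooth_map_has_derivative
        smooth_map_bilinear[OF p] J f g smooth_map_D)
  also have "\<dots> = (p (f t) (D J (D J g) t) + p (D J f t) (D J g t)) +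
      (p (D J f t) (D J g t) + p (D J (D J f) t) (g t))"
    by (intro arg_cong2[of _ _ _ _ "(+)"] D_bilinear[OF p] J sm f g smooth_map_D)
  finally show ?thesis by (simp add: numeral_2_eq_2 scaleR_2)
qed

section \<open>Polar vectors in the Hermitian space\<close>

lemma herm_eq:
  "herm z w = cnj (z$1) * (\<i> * w$3) + cnj (z$2) * w$2 - cnj (z$3) * (\<i> * w$1)"
  by (simp add: herm_def hmat_def matrix_vector_mult_def sum_3)

lemma cvec3_eq_iff: "u = v \<longleftrightarrow> u$1 = v$1 \<and> u$2 = v$2 \<and> u$3 = (v :: 'a^3)$3"
  by (simp add: vec_eq_iff forall_3)

lemma scaleR_eq_cscale: "r *\<^sub>R v = of_real r *s (v :: complex^'n)"
  by (simp add: vec_eq_iff scaleR_conv_of_real[where 'a=complex])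

lemma bounded_bilinear_herm: "bounded_bilinear herm"
  unfolding bilinear_conv_bounded_bilinear[symmetric] bilinear_def
  by (auto intro!: linearI simp: herm_eq algebra_simps scaleR_eq_cscale scaleR_conv_of_real[where 'a=complex])

lemma herm_cnj: "cnj (herm z w) = herm w z"
  by (simp add: herm_eq algebra_simps)

lemma herm_add_right: "herm u (v + w) = herm u v + herm u w"
  and herm_add_left: "herm (u + v) w = herm u w + herm v w"
  and herm_diff_right: "herm u (v - w) = herm u v - herm u w"
  and herm_diff_left: "herm (u - v) w = herm u w - herm v w"
  and herm_scale_right: "herm u (c *s v) = c * herm u v"
  and herm_scale_left: "herm (c *s u) v = cnj c * herm u v"
  by (simp_all add: herm_eq algebra_simps)

lemma herm_zero [simp]: "herm u 0 = 0" "herm 0 u = 0"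
  by (simp_all add: herm_eq)

lemmas herm_simps = herm_add_right herm_add_left herm_diff_right herm_diff_left herm_scale_right herm_scale_left

text \<open>The vector \<open>h\<close> applied to the conjugate of the complex cross product; it is characterized by
  \<open>herm_polar\<close> below.\<close>

definition polar :: "complex^3 \<Rightarrow> complex^3 \<Rightarrow> complex^3" where
  "polar u v = vector
     [\<i> * cnj (u$1 * v$2 - u$2 * v$1), cnj (u$3 * v$1 - u$1 * v$3), - \<i> * cnj (u$2 * v$3 - u$3 * v$2)]"

lemma herm_polar: "herm (polar u v) w = det (transpose (vector [u, v, w]))"
  by (simp add: polar_def herm_eq det_3 transpose_def algebra_simps)

lemma bounded_bilinear_polar: "bounded_bilinear polar"
  unfolding bilinear_conv_bounded_bilinear[symmetric] bilinear_def
  by (auto intro!: linearI simp: polar_def cvec3_eq_iff algebra_simps scaleR_eq_cscale)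

lemma polar_same [simp]: "polar u u = 0"
  and polar_scale_right: "polar u (c *s v) = cnj c *s polar u v"
  and polar_add_right: "polar u (v + w) = polar u v + polar u w"
  by (simp_all add: polar_def cvec3_eq_iff algebra_simps)

lemma herm_polar_left [simp]: "herm (polar u v) u = 0"
  and herm_polar_right [simp]: "herm (polar u v) v = 0"
  and herm_polar_swap: "herm (polar u v) w = - herm (polar u w) v"
  by (simp_all add: polar_def herm_eq algebra_simps)

text \<open>Minus the Gram determinant of \<open>u\<close>, \<open>v\<close>; the sign reflects that
  \<open>hmat\<close> has determinant -1.\<close>

lemma herm_polar_polar:
  "herm (polar u v) (polar u v) = herm u v * herm v u - herm u u * herm v v"
  by (simp add: polar_def herm_eq algebra_simps)

text \<open>Cramer's rule for expanding \<open>w\<close> in \<open>u\<close>, \<open>v\<close>,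
  \<open>a\<close>, with the determinants written through \<open>herm_polar\<close>.\<close>

lemma polar_cramer:
  "herm (polar u v) a *s w =
     herm (polar w v) a *s u + herm (polar u w) a *s v + herm (polar u v) w *s a"
  by (simp add: polar_def herm_eq cvec3_eq_iff algebra_simps)

lemma herm_self_real: "herm u u = of_real (Re (herm u u))"
  using herm_cnj[of u u] by (metis Reals_cnj_iff of_real_Re)

section \<open>Planes of signature (1,1) and their null vectors\<close>

lemma span2: "vec.span {u, v} = {a *s u + b *s v |a b. True}"
  by (auto simp: vec.span_insert vec.span_singleton image_iff diff_eq_eq add.commute)

text \<open>For a null vector \<open>u\<close>, the plane spanned by \<open>u, v\<close> has signature \<open>(1,1)\<close> precisely when
  \<open>herm u v \<noteq> 0\<close>.\<close>

lemma polar_spacelike: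
  assumes "herm u u = 0" "herm u v \<noteq> 0"
  shows "spacelike (polar u v)"
proof -
  have "herm (polar u v) (polar u v) = herm u v * cnj (herm u v)"
    using assms herm_cnj[of u v] by (simp add: herm_polar_polar)
  then have "Re (herm (polar u v) (polar u v)) = (cmod (herm u v))\<^sup>2"
    by (simp add: complex_mult_cnj cmod_power2)
  then have "Re (herm (polar u v) (polar u v)) > 0" using assms(2) by simp
  then show ?thesis unfolding spacelike_def by auto
qed

lemma spacelike_herm: "spacelike S \<Longrightarrow> herm S S \<noteq> 0"
  unfolding spacelike_def by auto

text \<open>Cramer's rule applies with \<open>polar u v\<close> as third vector: the determinant is
  then its square norm, nonzero because the polar vector is spacelike, and the coefficient of that
  third vector is \<open>herm (polar u v) w\<close>.\<close>

lemma span_iff_herm_polar: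
  assumes "herm u u = 0" "herm u v \<noteq> 0"
  shows "w \<in> vec.span {u, v} \<longleftrightarrow> herm (polar u v) w = 0"
proof
  assume "w \<in> vec.span {u, v}"
  then show "herm (polar u v) w = 0" by (auto simp: span2 herm_simps)
next
  let ?S = "polar u v"
  assume 0: "herm ?S w = 0"
  have S: "herm ?S ?S \<noteq> 0" using spacelike_herm[OF polar_spacelike[OF assms]] .
  have "herm ?S ?S *s w = herm (polar w v) ?S *s u + herm (polar u w) ?S *s v"
    using polar_cramer[of u v ?S w] 0 by simp
  then have "herm ?S ?S *s w \<in> vec.span {u, v}" by (auto simp: span2)
  then have "(1 / herm ?S ?S) *s (herm ?S ?S *s w) \<in> vec.span {u, v}" by (rule vec.span_scale)
  then show "w \<in> vec.span {u, v}" using S by simp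
qed

text \<open>Removing from \<open>S\<close> its orthogonal projection to the polar vector leaves a
  vector \<open>X\<close> of the plane that is orthogonal to the plane. The form is nondegenerate
  there, so \<open>X\<close> vanishes.\<close>

lemma orthogonal_imp_multiple_polar:
  assumes "herm u u = 0" "herm u v \<noteq> 0" "herm S u = 0" "herm S v = 0"
  shows "\<exists>c. S = c *s polar u v"
proof -
  let ?P = "polar u v"
  have P: "herm ?P ?P \<noteq> 0" using spacelike_herm[OF polar_spacelike[OF assms(1,2)]] .
  define X where "X = S - (herm ?P S / herm ?P ?P) *s ?P"
  have "herm ?P X = 0" using P by (simp add: X_def herm_simps)
  then obtain a b where X: "X = a *s u + b *s v"
    using span_iff_herm_polar[OF assms(1,2)] span2 by blast
  have "herm X u = 0" "herm X v = 0" using assms by (simp_all add: X_def herm_simps)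
  moreover have "herm v u \<noteq> 0" using assms(2) herm_cnj[of u v] by auto
  ultimately have "b = 0" "a = 0" using assms(1,2) by (auto simp: X herm_simps)
  then have "X = 0" by (simp add: X)
  then have "S = (herm ?P S / herm ?P ?P) *s ?P" by (simp add: X_def)
  then show ?thesis ..
qed

lemma null_pair_independent:
  assumes "herm u u = 0" "herm u v \<noteq> 0" "a *s u + b *s v = 0"
  shows "a = 0" "b = 0"
proof -
  have "herm u (a *s u + b *s v) = 0" using assms by simp
  then show b: "b = 0" using assms(1,2) by (simp add: herm_add_right herm_scale_right)
  have "u \<noteq> 0" using assms by auto
  then show "a = 0" using assms(3) b by simp
qed

text \<open>A plane of signature (1,1) has null lines other than that of \<open>u\<close>. Adding
  \<open>\<i> * y\<close> times \<open>u\<close> to \<open>v\<close> changes the square norm of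
  \<open>v\<close> by the real number \<open>2 * y * \<rho>\<close>, so a suitable \<open>y\<close>
  cancels it.\<close>

lemma second_null_vector:
  assumes "herm u u = 0" "herm u v = \<i> * of_real \<rho>" "\<rho> \<noteq> 0"
  obtains y :: real where "herm ((\<i> * y) *s u + v) ((\<i> * y) *s u + v) = 0"
proof
  let ?y = "- Re (herm v v) / (2 * \<rho>)"
  have "herm v u = - \<i> * \<rho>" using herm_cnj[of u v] assms(2) by simp
  then have "herm ((\<i> * ?y) *s u + v) ((\<i> * ?y) *s u + v) = 2 * ?y * \<rho> + herm v v"
    using assms(1,2) by (simp only: herm_simps) (simp add: algebra_simps)
  then show "herm ((\<i> * ?y) *s u + v) ((\<i> * ?y) *s u + v) = 0"
    using assms(3) herm_self_real[of v] by simp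
qed

section \<open>Projective lines, charts and chains\<close>

lemma proj_scale: "c \<noteq> 0 \<Longrightarrow> proj (c *s z) = proj z"
  unfolding proj_def by (rule vec.span_image_scale[of "{z}" "\<lambda>_. c", simplified])

lemma mem_proj: "w \<in> proj z \<longleftrightarrow> (\<exists>c. w = c *s z)"
  by (auto simp: proj_def vec.span_singleton)

lemma proj_self [simp]: "z \<in> proj z"
  by (simp add: proj_def vec.span_base)

lemma proj_subset_span_iff: "proj z \<subseteq> vec.span A \<longleftrightarrow> z \<in> vec.span A"
proof
  assume "z \<in> vec.span A"
  then show "proj z \<subseteq> vec.span A"
    unfolding proj_def by (intro vec.span_minimal vec.subspace_span) simp
qed (use proj_self in blast)

lemma proj_in_chart_dom_iff: "proj z \<in> chart_dom k \<longleftrightarrow> z $ k \<noteq> 0"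
proof
  show "proj z \<in> chart_dom k \<Longrightarrow> z $ k \<noteq> 0"
    by (auto simp: chart_dom_def mem_proj)
qed (rule proj_in_chart_dom)

lemma chart_proj_scale: "z $ k \<noteq> 0 \<Longrightarrow> chart k (proj z) = inverse (z $ k) *s z"
  by (simp add: chart_proj vec_eq_iff divide_inverse mult.commute)

lemma proj_in_chain_iff: "lightlike z \<Longrightarrow> proj z \<in> chain S \<longleftrightarrow> herm S z = 0"
proof -
  have "herm S z = 0" if "proj z = proj z'" "herm S z' = 0" for z'
    using that mem_proj[of z z'] proj_self[of z] by (auto simp: herm_simps)
  then show "lightlike z \<Longrightarrow> proj z \<in> chain S \<longleftrightarrow> herm S z = 0"
    by (auto simp: chain_def)
qed

lemma bounded_bilinear_cscale: "bounded_bilinear (\<lambda>(c::complex) (v::complex^'n). c *s v)"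
  unfolding bilinear_conv_bounded_bilinear[symmetric] bilinear_def
  by (auto intro!: linearI simp: vec_eq_iff algebra_simps scaleR_conv_of_real[where 'a=complex])

section \<open>Lifts and charts\<close>

lemma D_iter_linear:
  assumes "bounded_linear h" "dense_in_itself J" "smooth_map J f" "t \<in> J"
  shows "(D J ^^ n) (\<lambda>s. h (f s)) t = h ((D J ^^ n) f t)"
  using assms(4)
proof (induction n arbitrary: t)
  case (Suc n)
  have "(D J ^^ Suc n) (\<lambda>s. h (f s)) t = D J (\<lambda>s. h ((D J ^^ n) f s)) t"
    using D_cong_local[of UNIV t J "(D J ^^ n) (\<lambda>s. h (f s))" "\<lambda>s. h ((D J ^^ n) f s)"] Suc
    by simp
  also have "\<dots> = h (D J ((D J ^^ n) f) t)"
    by (rule D_linear) (use assms Suc.prems in \<open>auto simp: smooth_map_def\<close>)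
  finally show ?case by simp
qed simp

lemma D_iter_zero:
  assumes "dense_in_itself J" "\<And>s. s \<in> J \<Longrightarrow> f s = 0" "t \<in> J"
  shows "(D J ^^ n) f t = 0"
  using assms(3)
proof (induction n arbitrary: t)
  case (Suc n)
  have "(D J ^^ Suc n) f t = D J (\<lambda>s. 0) t"
    using D_cong_local[of UNIV t J "(D J ^^ n) f" "\<lambda>s. 0"] Suc by simp
  also have "\<dots> = 0"
    using assms(1) Suc.prems by (intro D_eqI has_vector_derivative_const)
  finally show ?case .
qed (simp add: assms(2))

lemma nonzero_near:
  assumes "smooth_map J f" "t \<in> J" "f t \<noteq> 0"
  obtains e where "e > 0" "\<And>s. s \<in> J \<inter> ball t e \<Longrightarrow> f s \<noteq> 0"
proof -
  have "continuous (at t within J) f" using assms(1,2) by (rule smooth_map_continuous)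
  from continuous_within_avoid[OF this assms(3)] show ?thesis using that by auto
qed

lemma smooth_map_nth:
  "dense_in_itself J \<Longrightarrow> smooth_map J B \<Longrightarrow> smooth_map J (\<lambda>s. B s $ k)"
  by (rule smooth_map_linear[OF bounded_linear_vec_nth])

lemma smooth_map_chart:
  assumes J: "dense_in_itself J" and B: "smooth_map J B"
    and c: "\<And>s. s \<in> J \<Longrightarrow> c s = proj (B s)" and k: "\<And>s. s \<in> J \<Longrightarrow> B s $ k \<noteq> 0"
  shows "smooth_map J (chart k \<circ> c)"
proof -
  have "smooth_map J (\<lambda>s. inverse (B s $ k) *s B s)"
    by (rule smooth_map_bilinear[OF bounded_bilinear_cscale J smooth_map_inverse[OF J k] B])
       (use J B smooth_map_nth in auto)
  then show ?thesis
    by (rule smooth_map_cong[THEN iffD1, rotated]) (simp add: c k chart_proj_scale)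
qed

lemma exists_nonzero_coordinate:
  assumes "(z :: complex^3) \<noteq> 0"
  obtains k where "z $ k \<noteq> 0"
  using assms by (metis vec_eq_iff zero_index)

text \<open>Some coordinate of the lift is nonzero at \<open>t\<close>, hence near \<open>t\<close>
  by continuity, and dividing by it gives the chart expression.\<close>

lemma smooth_curve_proj:
  assumes J: "dense_in_itself J" and B: "smooth_map J B"
    and c: "\<And>s. s \<in> J \<Longrightarrow> c s = proj (B s)" and nz: "\<And>s. s \<in> J \<Longrightarrow> B s \<noteq> 0"
  shows "smooth_curve J c"
  unfolding smooth_curve_def
proof (intro conjI ballI)
  show "c ` J \<subseteq> CP2" using c nz by (auto simp: CP2_def)
  fix t assume t: "t \<in> J"
  obtain k where k: "B t $ k \<noteq> 0" using exists_nonzero_coordinate nz[OF t] .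
  obtain e where e: "e > 0" "\<And>s. s \<in> J \<inter> ball t e \<Longrightarrow> B s $ k \<noteq> 0"
    using nonzero_near[OF smooth_map_nth[OF J B] t k] by blast
  have "smooth_map (J \<inter> ball t e) (chart k \<circ> c)"
    by (rule smooth_map_chart[of _ B])
       (use dense_in_itself_Int_open[OF J] smooth_map_Int_open[OF B] c e in auto)
  moreover have "c ` (J \<inter> ball t e) \<subseteq> chart_dom k"
    using e c by (auto simp: proj_in_chart_dom_iff)
  ultimately show "\<exists>k. \<exists>e>0. c ` (J \<inter> ball t e) \<subseteq> chart_dom k \<and>
      smooth_map (J \<inter> ball t e) (chart k \<circ> c)" using e(1) by blast
qed

text \<open>The Leibniz rule for \<open>B = B\<^sub>k \<cdot> (chart k \<circ> c)\<close> compares the jets of a lift with those of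
  the chart expression of the curve, without differentiating a quotient.\<close>

lemma chart_jet:
  assumes J: "dense_in_itself J" and B: "smooth_map J B"
    and c: "\<And>s. s \<in> J \<Longrightarrow> c s = proj (B s)" and t: "t \<in> J" and k: "B t $ k \<noteq> 0"
  defines "g \<equiv> chart k \<circ> c"
  shows "g differentiable (at t within J)"
    and "B t = B t $ k *s g t"
    and "D J B t = B t $ k *s D J g t + D J B t $ k *s g t"
    and "(D J ^^ 2) B t = B t $ k *s (D J ^^ 2) g t + 2 *\<^sub>R (D J B t $ k *s D J g t)
      + (D J ^^ 2) B t $ k *s g t"
proof -
  obtain e where e: "e > 0" "\<And>s. s \<in> J \<inter> ball t e \<Longrightarrow> B s $ k \<noteq> 0"
    using nonzero_near[OF smooth_map_nth[OF J B] t k] by blast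
  \<comment> \<open>On \<open>K\<close> the \<open>k\<close>-th coordinate has no zero, so the chart
    expression is smooth there; derivatives at \<open>t\<close> within \<open>K\<close> and within
    \<open>J\<close> agree.\<close>
  define K where "K = J \<inter> ball t e"
  have K: "dense_in_itself K" "t \<in> K" and BK: "smooth_map K B"
    using dense_in_itself_Int_open[OF J] smooth_map_Int_open[OF B] t e(1) by (auto simp: K_def)
  have g: "smooth_map K g"
    unfolding g_def by (rule smooth_map_chart[of _ B]) (use K BK c e in \<open>auto simp: K_def\<close>)
  show "g differentiable (at t within J)"
    using differentiable_cong_local[of "ball t e" t J g g] smooth_map_differentiable[OF g K(2)] K(2)
    by (simp add: K_def)
  have eq: "B s = B s $ k *s g s" if "s \<in> K" for s
    using that c e(2) by (auto simp: K_def g_def chart_proj vec_eq_iff)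
  then show "B t = B t $ k *s g t" using K by blast
  have nth: "(D K ^^ n) (\<lambda>s. B s $ k) t = (D K ^^ n) B t $ k" for n
    using D_iter_linear[OF bounded_linear_vec_nth K(1) BK K(2)] .
  have DJ: "(D J ^^ n) f t = (D K ^^ n) f t" for n and f :: "real \<Rightarrow> complex^3"
    using D_iter_cong_local[of "ball t e" J f f t n] K(2) by (simp add: K_def)
  have D1: "D J f t = D K f t" for f :: "real \<Rightarrow> complex^3" using DJ[of 1] by simp
  have DB: "(D K ^^ n) B t = (D K ^^ n) (\<lambda>s. B s $ k *s g s) t" for n
    using D_iter_cong_local[of UNIV K B "\<lambda>s. B s $ k *s g s" t n] eq K(2) by simp
  show "D J B t = B t $ k *s D J g t + D J B t $ k *s g t"
    using D_bilinear[OF bounded_bilinear_cscale K, of "\<lambda>s. B s $ k" g] DB[of 1] nth[of 1]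
      smooth_map_differentiable[OF smooth_map_nth[OF K(1) BK] K(2)]
      smooth_map_differentiable[OF g K(2)]
    by (simp add: D1)
  show "(D J ^^ 2) B t = B t $ k *s (D J ^^ 2) g t + 2 *\<^sub>R (D J B t $ k *s D J g t)
      + (D J ^^ 2) B t $ k *s g t"
    using D2_bilinear[OF bounded_bilinear_cscale K smooth_map_nth[OF K(1) BK] g, of k]
      DB[of 2] nth[of 2] nth[of 1] by (simp add: DJ D1)
qed

section \<open>Differentials and jets of projective curves through lifts\<close>

text \<open>With \<open>g\<close> the chart expression, the Leibniz rule reads
  \<open>B' = B_k g' + B'_k g\<close>, where \<open>g\<close> is a multiple of \<open>B\<close>.
  Hence \<open>g'\<close> vanishes exactly when \<open>B'\<close> is a multiple of
  \<open>B\<close>.\<close>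

lemma zero_differential_proj:
  assumes J: "dense_in_itself J" and B: "smooth_map J B"
    and c: "\<And>s. s \<in> J \<Longrightarrow> c s = proj (B s)" and t: "t \<in> J" and nz: "B t \<noteq> 0"
  shows "zero_differential J c t \<longleftrightarrow> (\<exists>l. D J B t = l *s B t)"
proof
  note jet = chart_jet[OF J B c t]
  assume zd: "zero_differential J c t"
  obtain k where k: "B t $ k \<noteq> 0" using exists_nonzero_coordinate nz .
  then have "((chart k \<circ> c) has_vector_derivative 0) (at t within J)"
    using zd c t by (auto simp: zero_differential_def proj_in_chart_dom_iff)
  then have "D J (chart k \<circ> c) t = 0" using J t D_eqI by blast
  then have "D J B t = D J B t $ k *s (chart k \<circ> c) t" using jet(3)[OF _ k] by simp
  moreover have "(chart k \<circ> c) t = inverse (B t $ k) *s B t"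
    using k c t by (simp add: chart_proj_scale)
  ultimately have "D J B t = (D J B t $ k * inverse (B t $ k)) *s B t"
    by simp
  then show "\<exists>l. D J B t = l *s B t" ..
next
  note jet = chart_jet[OF J B c t]
  assume "\<exists>l. D J B t = l *s B t"
  then obtain l where l: "D J B t = l *s B t" ..
  show "zero_differential J c t"
    unfolding zero_differential_def
  proof (intro allI impI)
    fix k assume "c t \<in> chart_dom k"
    then have k: "B t $ k \<noteq> 0" using c t by (simp add: proj_in_chart_dom_iff)
    let ?g = "chart k \<circ> c"
    have "l *s (B t $ k *s ?g t) = B t $ k *s D J ?g t + (l * B t $ k) *s ?g t"
      using jet(2,3)[OF _ k] l by simp
    then have "D J ?g t = 0" using k by simp
    then show "(?g has_vector_derivative 0) (at t within J)"
      using has_vector_derivative_D[OF jet(1)[OF _ k]] by simp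
  qed
qed

text \<open>The Leibniz relations between lift and chart expression form a triangular system with
  the nonzero diagonal entry \<open>B t $ k\<close>, so equal 2-jets of lifts give equal 2-jets in
  the chart, one order after another.\<close>

lemma same_jet_proj:
  assumes J: "dense_in_itself J" and B: "smooth_map J B"
    and c: "\<And>s. s \<in> J \<Longrightarrow> c s = proj (B s)" and t: "t \<in> J"
    and I: "dense_in_itself I" and A: "smooth_map I A"
    and b: "\<And>s. s \<in> I \<Longrightarrow> b s = proj (A s)" and tI: "t \<in> I"
    and eq: "A t = B t" "D I A t = D J B t" "(D I ^^ 2) A t = (D J ^^ 2) B t"
  shows "same_jet 2 J c I b t"
  unfolding same_jet_def
proof (intro allI impI)
  fix k i assume "c t \<in> chart_dom k" and i: "i \<le> (2::nat)"
  then have k: "B t $ k \<noteq> 0" using c t by (simp add: proj_in_chart_dom_iff)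
  then have kA: "A t $ k \<noteq> 0" using eq by simp
  note jB = chart_jet[OF J B c t k] and jA = chart_jet[OF I A b tI kA]
  have 0: "(chart k \<circ> c) t = (chart k \<circ> b) t" using c b t tI eq by simp
  have cancel: "z *s v = z *s w \<Longrightarrow> z \<noteq> 0 \<Longrightarrow> v = w" for z and v w :: "complex^3"
    by simp
  have "B t $ k *s D J (chart k \<circ> c) t = B t $ k *s D I (chart k \<circ> b) t"
    using jB(3) jA(3) eq(1,2) 0 by (metis add_right_cancel)
  then have 1: "D J (chart k \<circ> c) t = D I (chart k \<circ> b) t" by (rule cancel) (rule k)
  have "B t $ k *s (D J ^^ 2) (chart k \<circ> c) t = B t $ k *s (D I ^^ 2) (chart k \<circ> b) t"
    using jB(4) jA(4) eq 0 1 by (metis add_right_cancel)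
  then have 2: "(D J ^^ 2) (chart k \<circ> c) t = (D I ^^ 2) (chart k \<circ> b) t" by (rule cancel) (rule k)
  consider "i = 0" | "i = 1" | "i = 2" using i by linarith
  then show "(D J ^^ i) (chart k \<circ> c) t = (D I ^^ i) (chart k \<circ> b) t"
    using 0 1 2 by cases simp_all
qed

text \<open>A linear form whose kernel is definite has no zero on the null cone, so normalizing it to 1
  gives a global section of the tautological line bundle over the sphere.\<close>

lemma lightlike_normalizer_nonzero:
  assumes "lightlike z"
  shows "z$1 - \<i> * z$3 \<noteq> 0"
proof
  assume "z$1 - \<i> * z$3 = 0"
  then have z1: "z$1 = \<i> * z$3" by simp
  have "herm z z = 2 * (z$3 * cnj (z$3)) + z$2 * cnj (z$2)"
    by (simp add: herm_eq z1 algebra_simps)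
  also have "\<dots> = of_real (2 * (cmod (z$3))\<^sup>2 + (cmod (z$2))\<^sup>2)"
    by (simp only: complex_norm_square[symmetric]) simp
  finally have "complex_of_real (2 * (cmod (z$3))\<^sup>2 + (cmod (z$2))\<^sup>2) = 0"
    using assms by (simp add: lightlike_def)
  then have "2 * (cmod (z$3))\<^sup>2 + (cmod (z$2))\<^sup>2 = 0"
    by (simp only: of_real_eq_0_iff)
  then have "z$3 = 0" "z$2 = 0"
    by (simp_all add: add_nonneg_eq_0_iff)
  then have "z = 0" using z1 by (simp add: cvec3_eq_iff)
  then show False using assms by (simp add: lightlike_def)
qed

lemma lightlike_scale: "lightlike z \<Longrightarrow> c \<noteq> 0 \<Longrightarrow> lightlike (c *s z)"
  by (auto simp: lightlike_def herm_simps)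

lemma proj_eqD:
  assumes "proj z = proj w" "z \<noteq> 0"
  obtains c where "c \<noteq> 0" "z = c *s w"
  using assms mem_proj[of z w] proj_self[of z] by force

text \<open>Charts provide lifts only locally. The normalization makes them agree on overlaps, so
  they glue to a lift on all of \<open>J\<close>.\<close>

lemma exists_lift:
  assumes J: "dense_in_itself J" and "smooth_curve J \<gamma>" and "\<gamma> ` J \<subseteq> CRsphere"
  shows "\<exists>\<Gamma>. lift_of J \<gamma> \<Gamma>"
proof -
  \<comment> \<open>\<open>rep\<close> is an arbitrary choice of representatives with no continuity;
    normalization by \<open>?n\<close> removes the dependence on the choice.\<close>
  let ?n = "\<lambda>z::complex^3. z$1 - \<i> * z$3"
  define rep where "rep t = (SOME z. lightlike z \<and> \<gamma> t = proj z)" for t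
  define \<Gamma> where "\<Gamma> t = inverse (?n (rep t)) *s rep t" for t
  have rep: "lightlike (rep t)" "\<gamma> t = proj (rep t)" if "t \<in> J" for t
  proof -
    have "\<exists>z. lightlike z \<and> \<gamma> t = proj z" using assms(3) that by (auto simp: CRsphere_def)
    then have "lightlike (rep t) \<and> \<gamma> t = proj (rep t)" unfolding rep_def by (rule someI_ex)
    then show "lightlike (rep t)" "\<gamma> t = proj (rep t)" by auto
  qed
  \<comment> \<open>Any null representative of the line may replace \<open>rep\<close>; below it is
    the chart expression, which is smooth.\<close>
  have \<Gamma>: "\<Gamma> t = inverse (?n w) *s w" if t: "t \<in> J" and w: "lightlike w" "\<gamma> t = proj w" for t w
  proof -
    obtain c where c: "c \<noteq> 0" "w = c *s rep t"
      using proj_eqD[of w "rep t"] w rep[OF t] by (auto simp: lightlike_def)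
    then have "?n w = c * ?n (rep t)" by (simp add: algebra_simps)
    then show ?thesis using c by (simp add: \<Gamma>_def)
  qed
  have "smooth_map J \<Gamma>"
  proof (rule smooth_map_locally)
    fix t assume "t \<in> J"
    then obtain k e where e: "e > 0" and dom: "\<gamma> ` (J \<inter> ball t e) \<subseteq> chart_dom k"
      and g: "smooth_map (J \<inter> ball t e) (chart k \<circ> \<gamma>)"
      using assms(2) unfolding smooth_curve_def by blast
    let ?K = "J \<inter> ball t e" and ?g = "chart k \<circ> \<gamma>"
    have K: "dense_in_itself ?K" using dense_in_itself_Int_open[OF J] by simp
    have gs: "lightlike (?g s)" "\<gamma> s = proj (?g s)" if "s \<in> ?K" for s
    proof -
      have s: "lightlike (rep s)" "\<gamma> s = proj (rep s)" using rep that by auto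
      have "\<gamma> s \<in> chart_dom k" by (rule subsetD[OF dom imageI[OF that]])
      then have "rep s $ k \<noteq> 0" unfolding s(2) proj_in_chart_dom_iff .
      then show "lightlike (?g s)" "\<gamma> s = proj (?g s)"
        using s by (simp_all add: chart_proj_scale lightlike_scale proj_scale)
    qed
    have "smooth_map ?K (\<lambda>s. ?n (?g s))"
    proof -
      have "bounded_linear (\<lambda>z::complex^3. z$1 - \<i> * z$3)"
        by (intro bounded_linear_sub bounded_linear_vec_nth bounded_linear_mult_const
            bounded_linear_compose[OF bounded_linear_mult_right bounded_linear_vec_nth])
      from smooth_map_linear[OF this K g] show ?thesis .
    qed
    then have "smooth_map ?K (\<lambda>s. inverse (?n (?g s)))"
      by (rule smooth_map_inverse[OF K, rotated]) (rule lightlike_normalizer_nonzero[OF gs(1)])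
    from smooth_map_bilinear[OF bounded_bilinear_cscale K this g]
    have "smooth_map ?K \<Gamma>"
      by (rule smooth_map_cong[THEN iffD1, rotated]) (rule \<Gamma>[OF _ gs, symmetric]; simp)
    then show "\<exists>e>0. smooth_map (J \<inter> ball t e) \<Gamma>" using e by blast
  qed
  moreover have "lightlike (\<Gamma> t)" "\<gamma> t = proj (\<Gamma> t)" if "t \<in> J" for t
    using rep[OF that] lightlike_normalizer_nonzero
    by (simp_all add: \<Gamma>_def lightlike_scale proj_scale)
  ultimately show ?thesis unfolding lift_of_def by blast
qed

section \<open>The osculating curve\<close>

text \<open>This is the effect on \<open>u\<close>, \<open>v\<close> of multiplying a curve by a
  scalar function with value \<open>b\<close> and derivative \<open>b'\<close>.\<close>

lemma span2_rebase:
  assumes "b \<noteq> 0"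
  shows "vec.span {b *s u, b *s v + b' *s u} = vec.span {u, v :: complex^3}"
proof (rule vec.span_eq[THEN iffD2], intro conjI subsetI)
  fix x assume x: "x \<in> {b *s u, b *s v + b' *s u}"
  have "b *s u = b *s u + 0 *s v" "b *s v + b' *s u = b' *s u + b *s v"
    by (simp_all add: add.commute)
  then show "x \<in> vec.span {u, v}"
    using x unfolding span2 by blast
next
  fix x assume x: "x \<in> {u, v}"
  have "u = inverse b *s (b *s u) + 0 *s (b *s v + b' *s u)" using assms by simp
  moreover have "v = (- b' * inverse b * inverse b) *s (b *s u) + inverse b *s (b *s v + b' *s u)"
    using assms by (simp add: vec.scale_right_distrib)
  ultimately show "x \<in> vec.span {b *s u, b *s v + b' *s u}"
    using x unfolding span2 by blast
qed

text \<open>The lift is a parameter, so that the results can be instantiated for several lifts of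
  the same curve; this is how independence of the lift is obtained.\<close>

locale lifted_curve =
  fixes J :: "real set" and \<gamma> :: "real \<Rightarrow> (complex^3) set" and \<Gamma> :: "real \<Rightarrow> complex^3"
  assumes dense: "dense_in_itself J" and transversal: "transversal J \<gamma>" and lift: "lift_of J \<gamma> \<Gamma>"
begin

abbreviation "\<Gamma>' \<equiv> D J \<Gamma>"
abbreviation "\<Gamma>'' \<equiv> (D J ^^ 2) \<Gamma>"

lemma smooth: "smooth_map J \<Gamma>"
  and lightlike: "t \<in> J \<Longrightarrow> lightlike (\<Gamma> t)"
  and null: "t \<in> J \<Longrightarrow> herm (\<Gamma> t) (\<Gamma> t) = 0"
  and nonzero: "t \<in> J \<Longrightarrow> \<Gamma> t \<noteq> 0"
  and proj: "t \<in> J \<Longrightarrow> \<gamma> t = proj (\<Gamma> t)"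
  using lift by (auto simp: lift_of_def lightlike_def)

lemmas jet = chart_jet[OF dense smooth proj]

lemma null_derivative1:
  assumes "t \<in> J"
  shows "herm (\<Gamma> t) (\<Gamma>' t) + herm (\<Gamma>' t) (\<Gamma> t) = 0"
  using D_bilinear[OF bounded_bilinear_herm dense assms, of \<Gamma> \<Gamma>]
    D_iter_zero[OF dense _ assms, of "\<lambda>s. herm (\<Gamma> s) (\<Gamma> s)" 1] null
    smooth_map_differentiable[OF smooth assms] by simp

lemma null_derivative2:
  assumes "t \<in> J"
  shows "herm (\<Gamma> t) (\<Gamma>'' t) + 2 * herm (\<Gamma>' t) (\<Gamma>' t) + herm (\<Gamma>'' t) (\<Gamma> t) = 0"
  using D2_bilinear[OF bounded_bilinear_herm dense assms smooth smooth]
    D_iter_zero[OF dense _ assms, of "\<lambda>s. herm (\<Gamma> s) (\<Gamma> s)" 2] null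
  by (simp add: scaleR_2)

text \<open>Transversality is stated in charts. Passing to the lift multiplies the pairing by the
  squared modulus of \<open>\<Gamma> t $ k\<close>, the other term of \<open>\<Gamma>'\<close>
  dropping out because the chart vector is null. The value is imaginary by
  \<open>null_derivative1\<close>.\<close>

lemma herm_derivative:
  assumes t: "t \<in> J"
  obtains \<rho> :: real where "\<rho> \<noteq> 0" "herm (\<Gamma> t) (\<Gamma>' t) = \<i> * of_real \<rho>"
proof -
  obtain k where k: "\<Gamma> t $ k \<noteq> 0" using exists_nonzero_coordinate nonzero[OF t] .
  let ?g = "chart k \<circ> \<gamma>"
  have "herm (?g t) (?g t) = 0"
    using k null[OF t] proj[OF t] by (simp add: chart_proj_scale herm_simps)
  moreover have "herm (\<Gamma> t) (\<Gamma>' t) =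
      herm (\<Gamma> t $ k *s ?g t) (\<Gamma> t $ k *s D J ?g t + \<Gamma>' t $ k *s ?g t)"
    by (intro arg_cong2[of _ _ _ _ herm] jet t k)
  ultimately have "herm (\<Gamma> t) (\<Gamma>' t) = cnj (\<Gamma> t $ k) * \<Gamma> t $ k * herm (?g t) (D J ?g t)"
    by (simp only: herm_simps) simp
  moreover have "herm (?g t) (D J ?g t) \<noteq> 0"
  proof
    assume "herm (?g t) (D J ?g t) = 0"
    then have "contact_form (chart k (\<gamma> t)) (D J ?g t) = 0" by (simp add: contact_form_def)
    moreover have "\<gamma> t \<in> chart_dom k" using k proj[OF t] by (simp add: proj_in_chart_dom_iff)
    then have "contact_form (chart k (\<gamma> t)) (D J ?g t) > 0"
      using transversal t unfolding transversal_def by blast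
    ultimately show False by simp
  qed
  ultimately have "herm (\<Gamma> t) (\<Gamma>' t) \<noteq> 0" using k by simp
  moreover have "Re (herm (\<Gamma> t) (\<Gamma>' t)) = 0"
    using null_derivative1[OF t] herm_cnj[of "\<Gamma> t" "\<Gamma>' t", symmetric]
    by (simp add: complex_eq_iff)
  ultimately show ?thesis
    using that[of "Im (herm (\<Gamma> t) (\<Gamma>' t))"] by (auto simp: complex_eq_iff)
qed

lemma herm_derivative_nonzero: "t \<in> J \<Longrightarrow> herm (\<Gamma> t) (\<Gamma>' t) \<noteq> 0"
  by (rule herm_derivative) auto

text \<open>For every lift the span equals that of the chart expression and its derivative, by a
  triangular change of basis, so all lifts give the same plane.\<close>

lemma osculating_plane:
  assumes t: "t \<in> J"
  shows "osculating_plane J \<gamma> t = vec.span {\<Gamma> t, \<Gamma>' t}"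
  unfolding osculating_plane_def
proof (rule the_equality)
  show "\<exists>\<Lambda>. lift_of J \<gamma> \<Lambda> \<and> vec.span {\<Gamma> t, \<Gamma>' t} = vec.span {\<Lambda> t, D J \<Lambda> t}"
    using lift by blast
next
  fix W assume "\<exists>\<Lambda>. lift_of J \<gamma> \<Lambda> \<and> W = vec.span {\<Lambda> t, D J \<Lambda> t}"
  then obtain \<Lambda> where \<Lambda>: "lift_of J \<gamma> \<Lambda>" and W: "W = vec.span {\<Lambda> t, D J \<Lambda> t}" by blast
  interpret L: lifted_curve J \<gamma> \<Lambda> by unfold_locales (rule dense transversal \<Lambda>)+
  obtain k where k: "\<Gamma> t $ k \<noteq> 0" using exists_nonzero_coordinate nonzero[OF t] .
  have kL: "\<Lambda> t $ k \<noteq> 0" using k proj[OF t] L.proj[OF t] by (metis proj_in_chart_dom_iff)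
  let ?g = "chart k \<circ> \<gamma>"
  have "vec.span {\<Gamma> t, \<Gamma>' t} = vec.span {?g t, D J ?g t}"
    using span2_rebase[OF k, of "?g t" "D J ?g t" "\<Gamma>' t $ k"]
    by (simp only: jet(2)[OF _ t k, symmetric] jet(3)[OF _ t k, symmetric])
  moreover have "W = vec.span {?g t, D J ?g t}"
    using span2_rebase[OF kL, of "?g t" "D J ?g t" "L.\<Gamma>' t $ k"]
    by (simp only: L.jet(2)[OF _ t kL, symmetric] L.jet(3)[OF _ t kL, symmetric] W)
  ultimately show "W = vec.span {\<Gamma> t, \<Gamma>' t}" by simp
qed

lemma osculating_chain_mem:
  assumes t: "t \<in> J"
  shows "proj z \<in> osculating_chain J \<gamma> t \<longleftrightarrow>
    proj z \<in> CRsphere \<and> herm (polar (\<Gamma> t) (\<Gamma>' t)) z = 0"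
  unfolding osculating_chain_def osculating_plane[OF t] proj_subset_span_iff mem_Collect_eq
    span_iff_herm_polar[OF null[OF t] herm_derivative_nonzero[OF t]] ..

lemma osculating_chain_eq:
  assumes t: "t \<in> J"
  shows "osculating_chain J \<gamma> t = chain (polar (\<Gamma> t) (\<Gamma>' t))"
proof -
  have "L \<in> osculating_chain J \<gamma> t \<longleftrightarrow> L \<in> chain (polar (\<Gamma> t) (\<Gamma>' t))"
    if L: "L \<in> CRsphere" for L
  proof -
    obtain z where "lightlike z" "L = proj z" using L by (auto simp: CRsphere_def)
    then show ?thesis using osculating_chain_mem[OF t, of z] proj_in_chain_iff[of z] L by simp
  qed
  moreover have "osculating_chain J \<gamma> t \<subseteq> CRsphere" "chain S \<subseteq> CRsphere" for S
    by (auto simp: osculating_chain_def chain_def CRsphere_def)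
  ultimately show ?thesis by blast
qed

text \<open>The polar line is the only one defining this chain: the chain contains the line of
  \<open>\<Gamma> t\<close> and a second null line, which together span the osculating plane, so
  every \<open>S\<close> with the same chain is orthogonal to that plane.\<close>

lemma osculating_curve:
  assumes t: "t \<in> J"
  shows "osculating_curve J \<gamma> t = proj (polar (\<Gamma> t) (\<Gamma>' t))"
proof -
  note nd = null[OF t] herm_derivative_nonzero[OF t]
  let ?P = "polar (\<Gamma> t) (\<Gamma>' t)"
  show ?thesis
    unfolding osculating_curve_def
  proof (rule the_equality)
    show "\<exists>S. spacelike S \<and> proj ?P = proj S \<and> chain S = osculating_chain J \<gamma> t"
      using polar_spacelike[OF nd] osculating_chain_eq[OF t] by blast
  next
    fix P assume "\<exists>S. spacelike S \<and> P = proj S \<and> chain S = osculating_chain J \<gamma> t"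
    then obtain S where S: "spacelike S" "P = proj S" "chain S = chain ?P"
      using osculating_chain_eq[OF t] by blast
    obtain \<rho> where \<rho>: "\<rho> \<noteq> 0" "herm (\<Gamma> t) (\<Gamma>' t) = \<i> * of_real \<rho>"
      using herm_derivative[OF t] .
    obtain y :: real where y: "herm ((\<i> * y) *s \<Gamma> t + \<Gamma>' t) ((\<i> * y) *s \<Gamma> t + \<Gamma>' t) = 0"
      using second_null_vector[OF null[OF t] \<rho>(2,1)] .
    let ?n = "(\<i> * y) *s \<Gamma> t + \<Gamma>' t"
    have "?n \<noteq> 0" using null_pair_independent(2)[OF nd, of "\<i> * y" 1] by auto
    then have n: "lightlike ?n" using y by (simp add: lightlike_def)
    have "herm ?P ?n = 0" by (simp add: herm_simps)
    then have "herm S ?n = 0" using proj_in_chain_iff[OF n] S(3) by blast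
    moreover have S0: "herm S (\<Gamma> t) = 0"
      using proj_in_chain_iff[OF lightlike[OF t]] S(3) herm_polar_left by blast
    ultimately have "herm S (\<Gamma>' t) = 0" by (simp add: herm_simps)
    then obtain c where c: "S = c *s ?P"
      using orthogonal_imp_multiple_polar[OF nd S0] by blast
    then have "c \<noteq> 0" using S(1) by (auto simp: spacelike_def)
    then show "P = proj ?P" using S(2) c by (simp add: proj_scale)
  qed
qed

lemma smooth_polar: "smooth_map J (\<lambda>s. polar (\<Gamma> s) (\<Gamma>' s))"
  by (rule smooth_map_bilinear[OF bounded_bilinear_polar dense smooth smooth_map_D[OF smooth]])

text \<open>The other Leibniz term is \<open>polar (\<Gamma>' t) (\<Gamma>' t)\<close>, which
  vanishes.\<close>

lemma D_polar:
  assumes t: "t \<in> J"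
  shows "D J (\<lambda>s. polar (\<Gamma> s) (\<Gamma>' s)) t = polar (\<Gamma> t) (\<Gamma>'' t)"
  using D_bilinear[OF bounded_bilinear_polar dense t, of \<Gamma> \<Gamma>']
    smooth_map_differentiable[OF smooth t] smooth_map_differentiable[OF smooth_map_D[OF smooth] t]
  by (simp add: numeral_2_eq_2)

text \<open>By \<open>herm_polar\<close> the left side is the vanishing of the determinant of
  \<open>\<Gamma>\<close>, \<open>\<Gamma>'\<close>, \<open>\<Gamma>''\<close>; all three conditions
  are compared with it.\<close>

lemma inflection_iff_spanned:
  assumes t: "t \<in> J"
  shows "herm (polar (\<Gamma> t) (\<Gamma>' t)) (\<Gamma>'' t) = 0 \<longleftrightarrow> (\<exists>p q. \<Gamma>'' t = p *s \<Gamma> t + q *s \<Gamma>' t)"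
  unfolding span_iff_herm_polar[OF null[OF t] herm_derivative_nonzero[OF t], symmetric] span2
  by blast

lemma zero_differential_iff:
  assumes t: "t \<in> J"
  shows "zero_differential J (osculating_curve J \<gamma>) t \<longleftrightarrow>
    herm (polar (\<Gamma> t) (\<Gamma>' t)) (\<Gamma>'' t) = 0"
proof -
  have "polar (\<Gamma> t) (\<Gamma>' t) \<noteq> 0"
    using polar_spacelike[OF null[OF t] herm_derivative_nonzero[OF t]] by (simp add: spacelike_def)
  then have "zero_differential J (osculating_curve J \<gamma>) t \<longleftrightarrow>
      (\<exists>l. polar (\<Gamma> t) (\<Gamma>'' t) = l *s polar (\<Gamma> t) (\<Gamma>' t))"
    using zero_differential_proj[OF dense smooth_polar osculating_curve t] D_polar[OF t] by simp
  also have "\<dots> \<longleftrightarrow> herm (polar (\<Gamma> t) (\<Gamma>' t)) (\<Gamma>'' t) = 0"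
  proof
    assume "\<exists>l. polar (\<Gamma> t) (\<Gamma>'' t) = l *s polar (\<Gamma> t) (\<Gamma>' t)"
    then obtain l where "polar (\<Gamma> t) (\<Gamma>'' t) = l *s polar (\<Gamma> t) (\<Gamma>' t)" ..
    \<comment> \<open>Pairing with \<open>\<Gamma>' t\<close> kills the right side; exchanging two
      columns of the determinant then gives the claim up to sign.\<close>
    then have "herm (polar (\<Gamma> t) (\<Gamma>'' t)) (\<Gamma>' t) = 0" by (simp add: herm_simps)
    then show "herm (polar (\<Gamma> t) (\<Gamma>' t)) (\<Gamma>'' t) = 0"
      using herm_polar_swap[of "\<Gamma> t" "\<Gamma>' t" "\<Gamma>'' t"] by simp
  next
    assume "herm (polar (\<Gamma> t) (\<Gamma>' t)) (\<Gamma>'' t) = 0"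
    then obtain p q where "\<Gamma>'' t = p *s \<Gamma> t + q *s \<Gamma>' t"
      using inflection_iff_spanned[OF t] by blast
    then have "polar (\<Gamma> t) (\<Gamma>'' t) = cnj q *s polar (\<Gamma> t) (\<Gamma>' t)"
      by (simp add: polar_add_right polar_scale_right)
    then show "\<exists>l. polar (\<Gamma> t) (\<Gamma>'' t) = l *s polar (\<Gamma> t) (\<Gamma>' t)" ..
  qed
  finally show ?thesis .
qed

section \<open>Contact with the osculating chain\<close>

text \<open>The linear form \<open>?\<phi>\<close> vanishes along the chart expression of
  \<open>\<beta>\<close>, hence on its derivatives, which up to order 2 are those of the chart
  expression of \<open>\<gamma>\<close>. By the Leibniz formula \<open>\<Gamma>'' t\<close> is a
  combination of these vectors.\<close>

lemma contact_order_imp_inflection: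
  assumes t: "t \<in> J" and "contact_order_gt_1 J \<gamma> t"
  shows "herm (polar (\<Gamma> t) (\<Gamma>' t)) (\<Gamma>'' t) = 0"
proof -
  obtain I \<beta> where I: "open I" "t \<in> I" and \<beta>: "smooth_curve I \<beta>" "\<beta> ` I \<subseteq> osculating_chain J \<gamma> t"
    "\<beta> t = \<gamma> t" and sj: "same_jet 2 J \<gamma> I \<beta> t"
    using assms(2) unfolding contact_order_gt_1_def by blast
  obtain k e where e: "e > 0" "\<beta> ` (I \<inter> ball t e) \<subseteq> chart_dom k"
    and b: "smooth_map (I \<inter> ball t e) (chart k \<circ> \<beta>)"
    using \<beta>(1) I(2) unfolding smooth_curve_def by blast
  define K where "K = I \<inter> ball t e"
  have K: "dense_in_itself K" "t \<in> K"
    using dense_in_itself_open[of "I \<inter> ball t e"] I e by (auto simp: K_def)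
  have dom: "\<gamma> t \<in> chart_dom k" using e(2) K(2) \<beta>(3) by (force simp: K_def)
  then have k: "\<Gamma> t $ k \<noteq> 0" using proj[OF t] by (simp add: proj_in_chart_dom_iff)
  let ?\<phi> = "herm (polar (\<Gamma> t) (\<Gamma>' t))" and ?b = "chart k \<circ> \<beta>" and ?g = "chart k \<circ> \<gamma>"
  have zero: "?\<phi> (?b s) = 0" if "s \<in> K" for s
  proof -
    have s: "\<beta> s \<in> osculating_chain J \<gamma> t" "\<beta> s \<in> chart_dom k"
      using that \<beta>(2) e(2) by (auto simp: K_def)
    then obtain z where z: "\<beta> s = proj z" by (auto simp: osculating_chain_def CRsphere_def)
    then show ?thesis
      using s osculating_chain_mem[OF t, of z]
      by (simp add: proj_in_chart_dom_iff chart_proj_scale herm_simps)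
  qed
  have "?\<phi> ((D J ^^ i) ?g t) = 0" if "i \<le> 2" for i
  proof -
    have "(D J ^^ i) ?g t = (D I ^^ i) ?b t" using sj dom that unfolding same_jet_def by blast
    also have "\<dots> = (D K ^^ i) ?b t"
      using D_iter_cong_local[of "ball t e" I ?b ?b t i] K(2) by (simp add: K_def)
    finally have "?\<phi> ((D J ^^ i) ?g t) = (D K ^^ i) (\<lambda>s. ?\<phi> (?b s)) t"
      using D_iter_linear[OF bounded_bilinear.bounded_linear_right[OF bounded_bilinear_herm]
          K(1) b[folded K_def] K(2)] by simp
    then show ?thesis using D_iter_zero[OF K(1) zero K(2)] by simp
  qed
  from this[of 0] this[of 1] this[of 2] show ?thesis
    by (subst jet(4)[OF _ t k]) (simp_all add: herm_simps scaleR_eq_cscale)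
qed

end

text \<open>The second derivative is twice \<open>w\<close>, which accounts for the halves in the
  coefficients chosen below.\<close>

lemma quadratic_curve:
  fixes u v w :: "'a::real_normed_vector" and t :: real
  assumes I: "dense_in_itself I"
  defines "f \<equiv> \<lambda>s. u + (s - t) *\<^sub>R v + (s - t)\<^sup>2 *\<^sub>R w"
  shows "smooth_map I f"
    and "s \<in> I \<Longrightarrow> D I f s = v + (s - t) *\<^sub>R (2 *\<^sub>R w)"
    and "s \<in> I \<Longrightarrow> (D I ^^ 2) f s = 2 *\<^sub>R w"
proof -
  define g where "g = (\<lambda>s. v + (s - t) *\<^sub>R (2 *\<^sub>R w))"
  have g: "(g has_vector_derivative 2 *\<^sub>R w) (at s within I)" for s
    unfolding g_def by (auto intro!: derivative_eq_intros)
  have f: "(f has_vector_derivative g s) (at s within I)" for s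
    unfolding f_def g_def has_vector_derivative_def
    by (auto intro!: derivative_eq_intros simp: algebra_simps)
  show "smooth_map I f"
    by (rule smooth_map_primitive[OF I smooth_map_primitive[OF I smooth_map_const[OF I]]])
       (rule f g)+
  show D: "D I f s = v + (s - t) *\<^sub>R (2 *\<^sub>R w)" if "s \<in> I" for s
    using D_eqI[OF I that f] by (simp add: g_def)
  show "(D I ^^ 2) f s = 2 *\<^sub>R w" if "s \<in> I"
  proof -
    have "(D I ^^ 2) f s = D I g s"
      using D_cong_local[of UNIV s I "D I f" g] D that by (simp add: g_def numeral_2_eq_2)
    then show ?thesis using D_eqI[OF I that g] by simp
  qed
qed

context lifted_curve
begin

text \<open>On the chain, written as \<open>[e + r n]\<close> with null vectors \<open>e, n\<close> and real \<open>r\<close>, the 2-jet of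
  \<open>\<Gamma>\<close> prescribes the second order coefficient of \<open>r\<close>; the second derivative of
  \<open>herm \<Gamma> \<Gamma> = 0\<close> says that it is real. The complex factor \<open>f\<close> only adjusts the lift.\<close>

lemma inflection_imp_contact_order:
  assumes t: "t \<in> J" and inflection: "herm (polar (\<Gamma> t) (\<Gamma>' t)) (\<Gamma>'' t) = 0"
  shows "contact_order_gt_1 J \<gamma> t"
proof -
  obtain p q where pq: "\<Gamma>'' t = p *s \<Gamma> t + q *s \<Gamma>' t"
    using inflection inflection_iff_spanned[OF t] by blast
  obtain \<rho> where \<rho>: "\<rho> \<noteq> 0" "herm (\<Gamma> t) (\<Gamma>' t) = \<i> * of_real \<rho>"
    using herm_derivative[OF t] .
  obtain y :: real where y: "herm ((\<i> * y) *s \<Gamma> t + \<Gamma>' t) ((\<i> * y) *s \<Gamma> t + \<Gamma>' t) = 0"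
    using second_null_vector[OF null[OF t] \<rho>(2,1)] .
  define e where "e = \<Gamma> t"
  define n where "n = (\<i> * y) *s e + \<Gamma>' t"
  have \<Gamma>': "\<Gamma>' t = n - (\<i> * y) *s e" by (simp add: n_def)
  have ee: "herm e e = 0" using null[OF t] by (simp add: e_def)
  have nn: "herm n n = 0" using y by (simp add: e_def n_def)
  have en: "herm e n = \<i> * \<rho>" using \<rho>(2) ee by (simp add: n_def herm_simps) (simp add: e_def)
  have ne: "herm n e = - \<i> * \<rho>" using herm_cnj[of e n] en by simp
  have en0: "herm e n \<noteq> 0" using en \<rho>(1) by simp
  have \<Gamma>'': "\<Gamma>'' t = (p - q * (\<i> * y)) *s e + q *s n"
    unfolding pq \<Gamma>' by (simp add: e_def cvec3_eq_iff algebra_simps)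
  \<comment> \<open>The second derivative of the null condition, in the basis \<open>e\<close>,
    \<open>n\<close>, fixes the imaginary part of \<open>q\<close>.\<close>
  have "Im q = - 2 * y"
  proof -
    have "herm e (\<Gamma>'' t) = q * (\<i> * \<rho>)" "herm (\<Gamma>'' t) e = cnj q * (- \<i> * \<rho>)"
      unfolding \<Gamma>'' by (simp_all add: herm_simps ee en ne)
    moreover have "herm (\<Gamma>' t) (\<Gamma>' t) = - 2 * y * \<rho>"
      unfolding \<Gamma>' by (simp add: herm_simps ee en ne nn)
    ultimately have "q * (\<i> * \<rho>) + 2 * (- 2 * y * \<rho>) + cnj q * (- \<i> * \<rho>) = 0"
      using null_derivative2[OF t] by (simp add: e_def)
    then have "Re (q * (\<i> * \<rho>) + 2 * (- 2 * y * \<rho>) + cnj q * (- \<i> * \<rho>)) = 0" by simp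
    then have "\<rho> * (Im q + 2 * y) = 0" by (simp add: algebra_simps)
    then show ?thesis using \<rho>(1) by simp
  qed
  then have q: "q = of_real (Re q) - 2 * (\<i> * y)" by (simp add: complex_eq_iff)
  \<comment> \<open>The constants come from matching the 2-jet of \<open>f (e + r n)\<close> with
    that of \<open>\<Gamma>\<close>. The \<open>e\<close>-components give
    \<open>f' = - \<i> * y\<close> and \<open>f'' = p - q * (\<i> * y)\<close> at \<open>t\<close>;
    the \<open>n\<close>-component of second order gives \<open>2 * c - 2 * \<i> * y = q\<close>, so
    \<open>c\<close> is half the real part of \<open>q\<close>.\<close>
  define c where "c = Re q / 2"
  define r where "r = (\<lambda>s. (s - t) + (s - t)\<^sup>2 * c)"
  define v where "v = (\<lambda>s. e + (s - t) *\<^sub>R n + (s - t)\<^sup>2 *\<^sub>R (c *\<^sub>R n))"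
  define f where "f = (\<lambda>s. 1 + (s - t) *\<^sub>R (- \<i> * y) + (s - t)\<^sup>2 *\<^sub>R ((p - q * (\<i> * y)) / 2))"
  have v_eq: "v s = e + of_real (r s) *s n" for s
    by (simp add: v_def r_def scaleR_eq_cscale cvec3_eq_iff algebra_simps)
  have U: "dense_in_itself (UNIV :: real set)" by (simp add: dense_in_itself_open)
  \<comment> \<open>Within distance \<open>d1\<close> of \<open>t\<close> the factor
    \<open>f\<close> has no zero, so multiplying by it does not change the projective curve. Within
    \<open>d2\<close> the derivative \<open>1 + 2 c (s - t)\<close> of \<open>r\<close> has no zero,
    which makes the parametrization regular.\<close>
  have "smooth_map UNIV f" unfolding f_def by (rule quadratic_curve(1)[OF U])
  moreover have "f t \<noteq> 0" by (simp add: f_def)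
  ultimately obtain d1 where d1: "d1 > 0" "\<And>s. s \<in> UNIV \<inter> ball t d1 \<Longrightarrow> f s \<noteq> 0"
    using nonzero_near[of UNIV f t] by blast
  have "smooth_map UNIV (\<lambda>s. 1 + (s - t) *\<^sub>R (2 * c) + (s - t)\<^sup>2 *\<^sub>R 0)"
    by (rule quadratic_curve(1)[OF U])
  then obtain d2 where d2: "d2 > 0" "\<And>s. s \<in> UNIV \<inter> ball t d2 \<Longrightarrow> 1 + (s - t) * (2 * c) \<noteq> 0"
    using nonzero_near[of UNIV "\<lambda>s. 1 + (s - t) * (2 * c)" t] by auto
  define I where "I = ball t (min d1 d2)"
  have I: "open I" "is_interval I" "t \<in> I" "dense_in_itself I"
    using d1(1) d2(1) by (simp_all add: I_def is_interval_ball_real dense_in_itself_open)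
  have fI: "f s \<noteq> 0" and rI: "1 + (s - t) * (2 * c) \<noteq> 0" if "s \<in> I" for s
    using d1(2)[of s] d2(2)[of s] that by (auto simp: I_def)
  note vq = quadratic_curve[OF I(4), where u = e and t = t and v = n and w = "c *\<^sub>R n", folded v_def]
  note fq = quadratic_curve[OF I(4), where u = 1 and t = t and v = "- \<i> * y"
        and w = "(p - q * (\<i> * y)) / 2", folded f_def]
  define \<beta> where "\<beta> = (\<lambda>s. proj (v s))"
  have v0: "v s \<noteq> 0" for s
    using null_pair_independent(1)[OF ee en0, of 1 "of_real (r s)"] by (auto simp: v_eq)
  \<comment> \<open>Since \<open>r s\<close> is real and \<open>herm e n\<close> imaginary, the two
    cross terms cancel.\<close>
  have vv: "lightlike (v s)" for s
    using v0[of s] by (simp add: lightlike_def) (simp add: v_eq herm_simps ee en ne nn)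
  have "smooth_curve I \<beta>"
    by (rule smooth_curve_proj[OF I(4) vq(1)]) (simp_all add: \<beta>_def v0)
  moreover have "\<not> zero_differential I \<beta> s" if s: "s \<in> I" for s
  proof
    assume "zero_differential I \<beta> s"
    then obtain l where l: "D I v s = l *s v s"
      using zero_differential_proj[OF I(4) vq(1) _ s v0, of \<beta>] by (auto simp: \<beta>_def)
    have "D I v s = of_real (1 + (s - t) * (2 * c)) *s n"
      using vq(2)[OF s] by (simp add: scaleR_eq_cscale cvec3_eq_iff algebra_simps)
    \<comment> \<open>Independence of \<open>e\<close> and \<open>n\<close> forces
      \<open>l = 0\<close> from the first coefficient, and then the derivative of \<open>r\<close>
      would vanish.\<close>
    then have eq: "(- l) *s e + (of_real (1 + (s - t) * (2 * c)) - l * of_real (r s)) *s n = 0"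
      using l unfolding v_eq by (simp add: cvec3_eq_iff algebra_simps)
    from null_pair_independent[OF ee en0 this] have "complex_of_real (1 + (s - t) * (2 * c)) = 0" by simp
    then show False using rI[OF s] by (simp only: of_real_eq_0_iff)
  qed
  moreover have "\<beta> s \<in> osculating_chain J \<gamma> t" for s
  proof -
    have "herm (polar (\<Gamma> t) (\<Gamma>' t)) (v s) = 0"
      by (simp add: v_eq n_def e_def herm_simps)
    then show ?thesis using vv osculating_chain_mem[OF t, of "v s"] by (auto simp: \<beta>_def CRsphere_def)
  qed
  moreover have "\<beta> t = \<gamma> t" by (simp add: \<beta>_def v_def e_def proj[OF t])
  moreover have "same_jet 2 J \<gamma> I \<beta> t"
  proof (rule same_jet_proj[OF dense smooth proj t I(4) _ _ I(3)])
    \<comment> \<open>The rescaled lift of \<open>\<beta>\<close>, rather than \<open>v\<close>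
      itself, has the same 2-jet as \<open>\<Gamma>\<close> at \<open>t\<close>.\<close>
    let ?A = "\<lambda>s. f s *s v s"
    show "smooth_map I ?A"
      by (rule smooth_map_bilinear[OF bounded_bilinear_cscale I(4) fq(1) vq(1)])
    show "\<beta> s = proj (?A s)" if "s \<in> I" for s
      using fI[OF that] by (simp add: \<beta>_def proj_scale)
    have ft: "f t = 1" "v t = e" by (simp_all add: f_def v_def)
    then show "?A t = \<Gamma> t" by (simp add: e_def)
    show "D I ?A t = \<Gamma>' t"
      using D_bilinear[OF bounded_bilinear_cscale I(4,3) smooth_map_differentiable[OF fq(1) I(3)]
          smooth_map_differentiable[OF vq(1) I(3)]]
      by (simp add: vq(2)[OF I(3)] fq(2)[OF I(3)] ft \<Gamma>')
    have half: "2 *\<^sub>R (z / 2) = z" for z :: complex by (simp add: scaleR_conv_of_real)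
    have "(D I ^^ 2) ?A t = 2 *\<^sub>R (c *\<^sub>R n) + 2 *\<^sub>R ((- \<i> * y) *s n)
        + (2 *\<^sub>R ((p - q * (\<i> * y)) / 2)) *s e"
      using D2_bilinear[OF bounded_bilinear_cscale I(4,3) fq(1) vq(1)]
      by (simp add: vq(2,3)[OF I(3)] fq(2,3)[OF I(3)] ft)
    also have "\<dots> = (p - q * (\<i> * y)) *s e + (of_real (Re q) - 2 * (\<i> * y)) *s n"
      unfolding half by (simp add: c_def scaleR_eq_cscale cvec3_eq_iff algebra_simps)
    also have "\<dots> = \<Gamma>'' t"
      unfolding q[symmetric] \<Gamma>'' ..
    finally show "(D I ^^ 2) ?A t = \<Gamma>'' t" .
  qed
  ultimately show ?thesis
    unfolding contact_order_gt_1_def using I by blast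
qed

end

section \<open>Equivalence of the three conditions\<close>

theorem proposition3p3:
  fixes J :: "real set" and \<gamma> :: "real \<Rightarrow> (complex^3) set" and t\<^sub>0 :: real
  assumes "is_interval J" and "interior J \<noteq> {}"
    and "transversal J \<gamma>" and "t\<^sub>0 \<in> J"
  shows "(CR_inflection J \<gamma> t\<^sub>0 \<longleftrightarrow> zero_differential J (osculating_curve J \<gamma>) t\<^sub>0) \<and>
         (zero_differential J (osculating_curve J \<gamma>) t\<^sub>0 \<longleftrightarrow> contact_order_gt_1 J \<gamma> t\<^sub>0)"
proof -
  have J: "dense_in_itself J" using dense_in_itself_interval assms(1,2) .
  obtain \<Gamma> where \<Gamma>: "lift_of J \<gamma> \<Gamma>"
    using exists_lift[OF J, of \<gamma>] assms(3) unfolding transversal_def by blast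
  \<comment> \<open>\<open>CR_inflection\<close> only asserts some lift with vanishing determinant,
    so the criterion is established for every lift \<open>\<Lambda>\<close>.\<close>
  have main: "det (transpose (vector [\<Lambda> t\<^sub>0, D J \<Lambda> t\<^sub>0, (D J ^^ 2) \<Lambda> t\<^sub>0])) = 0 \<longleftrightarrow>
      zero_differential J (osculating_curve J \<gamma>) t\<^sub>0" if "lift_of J \<gamma> \<Lambda>" for \<Lambda>
  proof -
    interpret lifted_curve J \<gamma> \<Lambda> by unfold_locales (rule J assms(3) that)+
    show ?thesis using zero_differential_iff[OF assms(4)] by (simp only: herm_polar)
  qed
  interpret lifted_curve J \<gamma> \<Gamma> by unfold_locales (rule J assms(3) \<Gamma>)+
  have "zero_differential J (osculating_curve J \<gamma>) t\<^sub>0 \<longleftrightarrow> contact_order_gt_1 J \<gamma> t\<^sub>0"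
    using zero_differential_iff contact_order_imp_inflection inflection_imp_contact_order assms(4)
    by blast
  moreover have "CR_inflection J \<gamma> t\<^sub>0 \<longleftrightarrow> zero_differential J (osculating_curve J \<gamma>) t\<^sub>0"
    using main \<Gamma> unfolding CR_inflection_def by blast
  ultimately show ?thesis by blast
qed

end
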